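(* Let $$\mathcal{A}=\begin{pmatrix}\tau A & M\\ M & -\tau B\end{pmatrix},\qquad \mathcal{B}=\begin{pmatrix}\tau A & \bar M\\ \bar M & -\tau B\end{pmatrix}.$$ There exists a positive constant $C$, independent of $h$ and $\tau$, such that if $\tau\ge Ch^2$, then the GMRes method for the preconditioned system with matrix $R=\mathcal{A}\mathcal{B}^{-1}$ converges with an asymptotic linear convergence rate bounded by $$\theta=\frac{\rho(\mathcal{B}^{-1}\mathcal{A})}{2}.$$ Moreover, for all $k$, the GMRes residuals satisfy $$\frac{\|r_k\|_2}{\|r_0\|_2}\le C_0\,\theta^k,\qquad C_0=\frac{2^{m-1}C_R^m\,(1+\rho(E))\,\dim\mathbb{V}_{\mathcal{T}}}{(1-\rho(E))^m},$$ where $E=\mathcal{B}^{-1}\mathcal{A}-I$.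
   Context: Let $\Omega\subset\mathbb{R}^d$, $d\ge 1$, be a bounded polyhedral domain. The diffusion coefficients $a(x),b(x)$ are measurable (scalar, or symmetric matrix valued) functions on $\Omega$ satisfying the continuity and coercivity conditions $\lambda_a(x)|\xi|^2\le \xi^Ta(x)\xi\le\Lambda_a(x)|\xi|^2$ and $\lambda_b(x)|\xi|^2\le \xi^Tb(x)\xi\le\Lambda_b(x)|\xi|^2$ for all $\xi\in\mathbb{R}^d$, where $\lambda_a,\lambda_b$ are bounded below by positive constants and $\Lambda_a,\Lambda_b$ are bounded above. Let $\mathcal{T}$ be a shape-regular triangulation of $\Omega$ with meshsize $h$ (the shape-regularity constant being fixed as $h$ varies), and let $\mathbb{V}_{\mathcal{T}}\subset H^1_0(\Omega)$ be the space of continuous piecewise linear finite element functions over $\mathcal{T}$ vanishing on $\partial\Omega$, with nodal basis $\phi_1,\dots,\phi_{N_h}$, $N_h=\dim\mathbb{V}_{\mathcal{T}}$. Define the $N_h\times N_h$ matrices $$M_{ij}=\int_\Omega\phi_i\phi_j,\quad A_{ij}=\int_\Omega a\nabla\phi_i\cdot\nabla\phi_j,\quad B_{ij}=\int_\Omega b\nabla\phi_i\cdot\nabla\phi_j .$$ The lumped mass matrix $\bar M$ is the diagonal matrix whose diagonal entries are the row sums of $M$. The parameter $\tau>0$ is the square root of the time-step size. "Independent of $h$ and $\tau$" means that the constant may depend only on $\Omega$, the diffusion coefficients and the shape regularity of the triangulations. $\rho(\cdot)$ denotes spectral radius. GMRes: to solve $Rv=b$, start from an initial iterate $v_0$ with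 residual $r_0=b-Rv_0\ne 0$; the residuals $r_k=b-Rv_k$ of the iterates $v_k$ satisfy $\|r_k\|_2=\min\{\|p(R)r_0\|_2: p \text{ a polynomial of degree}\le k,\ p(0)=1\}$, with $\|\cdot\|_2$ the Euclidean norm. "Asymptotic linear convergence rate bounded by $\theta$" means $\|r_k\|_2\le c\,\theta^k\|r_0\|_2$ for all $k$ with a constant $c$ independent of $k$. Constants: $R$ is a square matrix of order $n=2N_h$; $V$ is a nonsingular matrix transforming $R$ into its Jordan canonical form $J$, i.e. $V^{-1}RV=J$; $\kappa(V)$ is the condition number of $V$; $p$ is the number of Jordan blocks and $m$ is the size of the largest Jordan block of $R$; and $C_R:=n(1+\sqrt{n-p})\,\kappa(V)$. *)

theory Defs
  imports
    "HOL-Analysis.Analysis"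
    "HOL-Library.Function_Algebras"
    "Jordan_Normal_Form.Jordan_Normal_Form"
    "Jordan_Normal_Form.Gauss_Jordan_Elimination"
    "Jordan_Normal_Form.Spectral_Radius"
begin

text \<open>
  The matrix theory below is \<^theory>\<open>Jordan_Normal_Form.Matrix\<close>, since the orders of the matrices
  depend on the mesh; the type \<^typ>\<open>real ^ 'd\<close> is only used for the points and gradients in
  Euclidean space, and \<^typ>\<open>real ^ 'd ^ 'd\<close> for the values of the diffusion coefficients.
\<close>

section \<open>Domain and diffusion coefficients\<close>

text \<open>The boundary may be non-Lipschitz and may contain cracks; \<^const>\<open>polytope\<close> includes the
  degenerate polytopes, and those making up the frontier of an open set are necessarily flat.\<close>

definition polyhedral_domain :: "(real ^ 'd) set \<Rightarrow> bool" where
  "polyhedral_domain \<Omega> \<longleftrightarrow>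
     open \<Omega> \<and> connected \<Omega> \<and> \<Omega> \<noteq> {} \<and>
     (\<exists>F. finite F \<and> (\<forall>P\<in>F. polytope P) \<and> frontier \<Omega> = \<Union>F)"

text \<open>A scalar coefficient \<open>\<alpha>\<close> is the matrix-valued coefficient \<open>\<lambda>x. Finite_Cartesian_Product.mat (\<alpha> x)\<close>.\<close>

definition diffusion_coefficient :: "(real ^ 'd) set \<Rightarrow> (real ^ 'd \<Rightarrow> real ^ 'd ^ 'd) \<Rightarrow> bool" where
  "diffusion_coefficient \<Omega> a \<longleftrightarrow>
     a \<in> borel_measurable (lebesgue_on \<Omega>) \<and>
     (\<forall>x\<in>\<Omega>. Finite_Cartesian_Product.transpose (a x) = a x) \<and>
     (\<exists>lam Lam. (\<forall>x\<in>\<Omega>. \<forall>\<xi>.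
          lam x * (norm \<xi>)\<^sup>2 \<le> inner \<xi> (a x *v \<xi>) \<and> inner \<xi> (a x *v \<xi>) \<le> Lam x * (norm \<xi>)\<^sup>2) \<and>
        (\<exists>c>0. \<forall>x\<in>\<Omega>. c \<le> lam x) \<and> (\<exists>c. \<forall>x\<in>\<Omega>. Lam x \<le> c))"

section \<open>Meshes and linear finite elements\<close>

text \<open>Conformity (cells meet in common faces) is part of \<^const>\<open>triangulation\<close>. The last condition
  says that the frontier is resolved by the mesh; it only matters if \<open>\<Omega>\<close> differs from the
  interior of its closure.\<close>

definition triangulates :: "(real ^ 'd) set set \<Rightarrow> (real ^ 'd) set \<Rightarrow> bool" where
  "triangulates T \<Omega> \<longleftrightarrow>
     triangulation T \<and> (\<forall>K\<in>T. int CARD('d) simplex K) \<and> \<Union>T = closure \<Omega> \<and>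
     (\<forall>x\<in>frontier \<Omega>. \<exists>K\<in>T. \<exists>F. F face_of K \<and> x \<in> F \<and> F \<subseteq> frontier \<Omega>)"

definition mesh_size :: "(real ^ 'd) set set \<Rightarrow> real" where
  "mesh_size T = Max (diameter ` T)"

definition inradius :: "(real ^ 'd) set \<Rightarrow> real" where
  "inradius K = Sup {r. 0 \<le> r \<and> (\<exists>x. cball x r \<subseteq> K)}"

definition shape_regular :: "real \<Rightarrow> (real ^ 'd) set set \<Rightarrow> bool" where
  "shape_regular \<sigma> T \<longleftrightarrow> (\<forall>K\<in>T. diameter K \<le> \<sigma> * (2 * inradius K))"

text \<open>Finite element functions are extended by zero outside the domain, so that they are determined
  by their restrictions to the domain.\<close>

definition fe_space :: "(real ^ 'd) set \<Rightarrow> (real ^ 'd) set set \<Rightarrow> (real ^ 'd \<Rightarrow> real) set" where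
  "fe_space \<Omega> T = {v. continuous_on (closure \<Omega>) v \<and>
     (\<forall>K\<in>T. \<exists>g c. \<forall>x\<in>K. v x = inner g x + c) \<and> (\<forall>x. x \<notin> \<Omega> \<longrightarrow> v x = 0)}"

definition fe_dim :: "(real ^ 'd) set \<Rightarrow> (real ^ 'd) set set \<Rightarrow> nat" where
  "fe_dim \<Omega> T = vector_space.dim (\<lambda>(c::real) v x. c * v x) (fe_space \<Omega> T)"

definition interior_nodes :: "(real ^ 'd) set \<Rightarrow> (real ^ 'd) set set \<Rightarrow> (real ^ 'd) set" where
  "interior_nodes \<Omega> T = {x \<in> \<Omega>. \<exists>K\<in>T. x extreme_point_of K}"

definition nodal_basis ::
  "(real ^ 'd) set \<Rightarrow> (real ^ 'd) set set \<Rightarrow> nat \<Rightarrow> (nat \<Rightarrow> real ^ 'd \<Rightarrow> real) \<Rightarrow> bool" where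
  "nodal_basis \<Omega> T N \<phi> \<longleftrightarrow>
     (\<exists>z. bij_betw z {..<N} (interior_nodes \<Omega> T) \<and>
        (\<forall>i<N. \<phi> i \<in> fe_space \<Omega> T \<and> (\<forall>j<N. \<phi> i (z j) = (if i = j then 1 else 0))))"

text \<open>The classical gradient; finite element functions have it off the cell boundaries, i.e. almost
  everywhere, which is enough for the integrals below.\<close>

definition grad :: "(real ^ 'd \<Rightarrow> real) \<Rightarrow> real ^ 'd \<Rightarrow> real ^ 'd" where
  "grad f x = (\<chi> i. frechet_derivative f (at x) (axis i 1))"

section \<open>System matrices\<close>

definition mass_matrix ::
  "(real ^ 'd) set \<Rightarrow> nat \<Rightarrow> (nat \<Rightarrow> real ^ 'd \<Rightarrow> real) \<Rightarrow> real Matrix.mat" where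
  "mass_matrix \<Omega> N \<phi> = Matrix.mat N N (\<lambda>(i, j). LINT x:\<Omega>|lebesgue. \<phi> i x * \<phi> j x)"

definition stiffness_matrix ::
  "(real ^ 'd) set \<Rightarrow> (real ^ 'd \<Rightarrow> real ^ 'd ^ 'd) \<Rightarrow> nat \<Rightarrow> (nat \<Rightarrow> real ^ 'd \<Rightarrow> real) \<Rightarrow> real Matrix.mat"
  where
  "stiffness_matrix \<Omega> a N \<phi> =
     Matrix.mat N N (\<lambda>(i, j). LINT x:\<Omega>|lebesgue. inner (a x *v grad (\<phi> i) x) (grad (\<phi> j) x))"

definition lumped :: "real Matrix.mat \<Rightarrow> real Matrix.mat" where
  "lumped M = mat_diag (dim_row M) (\<lambda>i. \<Sum>j<dim_col M. M $$ (i, j))"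

definition saddle_matrix ::
  "real \<Rightarrow> real Matrix.mat \<Rightarrow> real Matrix.mat \<Rightarrow> real Matrix.mat \<Rightarrow> real Matrix.mat" where
  "saddle_matrix \<tau> A B M = four_block_mat (\<tau> \<cdot>\<^sub>m A) M M (- (\<tau> \<cdot>\<^sub>m B))"

text \<open>Meaningful for invertible matrices only.\<close>

definition mat_inv :: "'a :: field Matrix.mat \<Rightarrow> 'a Matrix.mat" where
  "mat_inv A = the (mat_inverse A)"

section \<open>Norms, condition number, GMRes\<close>

definition vec_norm2 :: "'a :: real_normed_field Matrix.vec \<Rightarrow> real" where
  "vec_norm2 v = L2_set (\<lambda>i. norm (vec_index v i)) {..<dim_vec v}"

definition mat_norm2 :: "'a :: real_normed_field Matrix.mat \<Rightarrow> real" where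
  "mat_norm2 A = Sup {vec_norm2 (A *\<^sub>v v) | v. v \<in> carrier_vec (dim_col A) \<and> vec_norm2 v = 1}"

definition cond2 :: "'a :: real_normed_field Matrix.mat \<Rightarrow> real" where
  "cond2 V = mat_norm2 V * mat_norm2 (mat_inv V)"

definition poly_mat :: "'a :: comm_ring_1 poly \<Rightarrow> 'a Matrix.mat \<Rightarrow> 'a Matrix.mat" where
  "poly_mat p R = Matrix.mat (dim_row R) (dim_row R)
     (\<lambda>(i, j). \<Sum>k\<le>degree p. poly.coeff p k * (R ^\<^sub>m k) $$ (i, j))"

definition residual :: "real Matrix.mat \<Rightarrow> real Matrix.vec \<Rightarrow> real Matrix.vec \<Rightarrow> real Matrix.vec" where
  "residual R b v = b - R *\<^sub>v v"

definition gmres_iterates ::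
  "real Matrix.mat \<Rightarrow> real Matrix.vec \<Rightarrow> (nat \<Rightarrow> real Matrix.vec) \<Rightarrow> bool" where
  "gmres_iterates R b v \<longleftrightarrow>
     b \<in> carrier_vec (dim_row R) \<and> (\<forall>k. v k \<in> carrier_vec (dim_row R)) \<and>
     residual R b (v 0) \<noteq> 0\<^sub>v (dim_row R) \<and>
     (\<forall>k. let S = {vec_norm2 (poly_mat p R *\<^sub>v residual R b (v 0)) | p. degree p \<le> k \<and> poly p 0 = 1}
          in vec_norm2 (residual R b (v k)) \<in> S \<and> (\<forall>s\<in>S. vec_norm2 (residual R b (v k)) \<le> s))"

definition gmres_rate_bounded :: "real Matrix.mat \<Rightarrow> real \<Rightarrow> bool" where
  "gmres_rate_bounded R \<theta> \<longleftrightarrow>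
     (\<exists>c. \<forall>b v. gmres_iterates R b v \<longrightarrow>
        (\<forall>k. vec_norm2 (residual R b (v k)) \<le> c * \<theta> ^ k * vec_norm2 (residual R b (v 0))))"

text \<open>\<open>V\<close> transforms \<open>R\<close> into the Jordan matrix with the given list of block sizes and eigenvalues,
  none of the blocks being of size zero.\<close>

definition jordan_transformation ::
  "complex Matrix.mat \<Rightarrow> complex Matrix.mat \<Rightarrow> (nat \<times> complex) list \<Rightarrow> bool" where
  "jordan_transformation R V bs \<longleftrightarrow>
     V \<in> carrier_mat (dim_row R) (dim_row R) \<and> invertible_mat V \<and> 0 \<notin> fst ` set bs \<and>
     mat_inv V * R * V = jordan_matrix bs"

definition jordan_constant :: "nat \<Rightarrow> complex Matrix.mat \<Rightarrow> (nat \<times> complex) list \<Rightarrow> real" where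
  "jordan_constant n V bs = real n * (1 + sqrt (real n - real (length bs))) * cond2 V"

definition max_block :: "(nat \<times> complex) list \<Rightarrow> nat" where
  "max_block bs = Max (fst ` set bs)"

end

theory Submission
  imports Defs
begin

text \<open>
  The defect \<open>\<Delta> = lumped M - M\<close> satisfies \<open>p\<^sup>T \<Delta> p = \<Sum>\<^sub>i\<^sub>j M\<^sub>i\<^sub>j (p\<^sub>i - p\<^sub>j)\<^sup>2 / 2\<close>. On a cell
  two nodal values differ by at most \<open>h\<close> times the norm of the gradient, so \<open>\<Delta>\<close> is bounded by a
  multiple of \<open>h\<^sup>2\<close> times the stiffness matrices, uniformly in the mesh. Testing an eigenvector
  \<open>(u, v)\<close> of the pencil, with eigenvalue \<open>1 + \<mu>\<close>, against \<open>(u, 0)\<close> and \<open>(0, v)\<close> and eliminating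
  the terms with the lumped mass matrix gives
  \<open>\<tau> (u\<^sup>* A u + v\<^sup>* B v) = (1 / cnj \<mu> - 1 / \<mu>) u\<^sup>* \<Delta> v\<close>, hence \<open>\<bar>\<mu>\<bar> \<le> 1 / 6\<close> as soon as
  \<open>\<tau> \<ge> C h\<^sup>2\<close> with \<open>C\<close> large.

  Then \<open>\<theta> \<ge> 5 / 12 = 1 / 6 + 1 / 4\<close>, and with the polynomial \<open>(1 - x)\<^sup>k\<close> the entries of the \<open>k\<close>-th
  power of the shifted Jordan matrix are at most
  \<open>(k choose d) (1 / 6)\<^sup>k\<^sup>-\<^sup>d \<le> 4\<^sup>d (1 / 6 + 1 / 4)\<^sup>k \<le> 4\<^sup>m\<^sup>-\<^sup>1 \<theta>\<^sup>k\<close>, where \<open>d < m\<close>. The factor \<open>4\<^sup>m\<^sup>-\<^sup>1\<close> is absorbed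
  by \<open>2\<^sup>m\<^sup>-\<^sup>1\<close> and the power \<open>m\<close> of \<open>C\<^sub>R \<ge> 2\<close>.
\<close>

section \<open>Norms and condition numbers\<close>

lemma vec_norm2_nonneg [simp]: "0 \<le> vec_norm2 v"
  by (simp add: vec_norm2_def)

lemma vec_norm2_eq_0_iff: "vec_norm2 v = 0 \<longleftrightarrow> v = 0\<^sub>v (dim_vec v)"
  by (auto simp: vec_norm2_def L2_set_eq_0_iff intro!: eq_vecI)
     (metis index_zero_vec(1))

lemma vec_norm2_smult: "vec_norm2 (c \<cdot>\<^sub>v v) = norm c * vec_norm2 v"
  by (auto simp: vec_norm2_def norm_mult L2_set_right_distrib[of "norm c"] intro!: L2_set_cong)

lemma vec_norm2_map_of_real:
  "vec_norm2 (map_vec complex_of_real v) = vec_norm2 v"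
  by (auto simp: vec_norm2_def intro!: L2_set_cong)

text \<open>Cauchy-Schwarz in a row costs a factor \<open>sqrt n\<close>, and adding up the
  \<open>n\<close> rows costs a second one. This is where the factor \<open>n\<close> of the
  constant \<open>C\<^sub>R\<close> comes from.\<close>

lemma vec_norm2_mult_entries_le:
  fixes A :: "'a :: real_normed_field Matrix.mat"
  assumes A: "A \<in> carrier_mat n n" and x: "x \<in> carrier_vec n"
    and K: "norm_bound A K"
  shows "vec_norm2 (A *\<^sub>v x) \<le> real n * K * vec_norm2 x"
proof (cases "n = 0")
  case True
  then show ?thesis using A by (simp add: vec_norm2_def)
next
  case False
  have K': "norm (A $$ (i,j)) \<le> K" if "i < n" "j < n" for i j
    using K A that by (auto simp: norm_bound_def)
  have K0: "0 \<le> K" using K'[of 0 0] False norm_ge_zero order_trans by blast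
  have "norm (vec_index (A *\<^sub>v x) i) \<le> sqrt (real n) * K * vec_norm2 x" if i: "i < n" for i
  proof -
    have "vec_index (A *\<^sub>v x) i = (\<Sum>j<n. A $$ (i,j) * vec_index x j)"
      using A x i by (auto simp: scalar_prod_def atLeast0LessThan intro!: sum.cong)
    also have "norm \<dots> \<le> (\<Sum>j<n. \<bar>K\<bar> * \<bar>norm (vec_index x j)\<bar>)"
      by (rule order_trans[OF norm_sum sum_mono]) (use K' i in \<open>auto simp: norm_mult K0 intro!: mult_right_mono\<close>)
    also have "\<dots> \<le> L2_set (\<lambda>_. K) {..<n} * L2_set (\<lambda>j. norm (vec_index x j)) {..<n}"
      by (rule L2_set_mult_ineq)
    also have "\<dots> = sqrt (real n) * K * vec_norm2 x"
      using x K0 by (simp add: L2_set_def vec_norm2_def real_sqrt_mult)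
    finally show ?thesis .
  qed
  then have "vec_norm2 (A *\<^sub>v x) \<le> L2_set (\<lambda>_. sqrt (real n) * K * vec_norm2 x) {..<n}"
    using A by (auto simp: vec_norm2_def intro!: L2_set_mono)
  also have "\<dots> = sqrt (real n) * (sqrt (real n) * K * vec_norm2 x)"
    using K0 by (simp add: L2_set_def real_sqrt_mult)
  finally show ?thesis by (simp add: mult.assoc[symmetric])
qed

text \<open>A real \<open>Sup\<close> is informative only for sets bounded above; a largest entry
  supplies the bound and makes \<open>mat_norm2\<close> usable.\<close>

lemma bdd_above_mat_norm2:
  fixes A :: "'a :: real_normed_field Matrix.mat"
  assumes A: "A \<in> carrier_mat n n"
  shows "bdd_above {vec_norm2 (A *\<^sub>v v) | v. v \<in> carrier_vec (dim_col A) \<and> vec_norm2 v = 1}"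
proof -
  have "norm_bound A (Max {norm (A $$ (i,j)) | i j. i < dim_row A \<and> j < dim_col A})"
    by (rule norm_bound_max)
  then obtain K where K: "norm_bound A K" by blast
  show ?thesis
    by (rule bdd_aboveI[of _ "real n * K"])
       (use vec_norm2_mult_entries_le[OF A _ K] A in fastforce)
qed

lemma vec_norm2_mult_le:
  fixes A :: "'a :: real_normed_field Matrix.mat"
  assumes A: "A \<in> carrier_mat n n" and x: "x \<in> carrier_vec n"
  shows "vec_norm2 (A *\<^sub>v x) \<le> mat_norm2 A * vec_norm2 x"
proof (cases "vec_norm2 x = 0")
  case True
  then have "x = 0\<^sub>v n" using x vec_norm2_eq_0_iff[of x] by auto
  then have "A *\<^sub>v x = 0\<^sub>v n" using A by auto
  then show ?thesis using True vec_norm2_eq_0_iff[of "A *\<^sub>v x"] A by simp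
next
  case False
  \<comment> \<open>Rescaling \<open>x\<close> to norm 1 makes it a competitor in the
    supremum.\<close>
  define c where "c = (of_real (1 / vec_norm2 x) :: 'a)"
  have nc: "norm c = 1 / vec_norm2 x" by (simp add: c_def norm_divide)
  have "vec_norm2 (A *\<^sub>v (c \<cdot>\<^sub>v x)) \<le> mat_norm2 A" unfolding mat_norm2_def
    by (rule cSup_upper[OF _ bdd_above_mat_norm2[OF A]])
       (use x A False nc in \<open>auto simp: vec_norm2_smult intro!: exI[of _ "c \<cdot>\<^sub>v x"]\<close>)
  moreover have "A *\<^sub>v (c \<cdot>\<^sub>v x) = c \<cdot>\<^sub>v (A *\<^sub>v x)" using A x by (simp add: mult_mat_vec)
  ultimately have "vec_norm2 (A *\<^sub>v x) / vec_norm2 x \<le> mat_norm2 A"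
    by (simp add: vec_norm2_smult nc)
  then show ?thesis using False vec_norm2_nonneg[of x]
    by (simp add: divide_le_eq)
qed

text \<open>Test on a unit vector. For \<open>n = 0\<close> no vector has norm 1 and the supremum
  runs over the empty set, hence the positive order.\<close>

lemma mat_norm2_nonneg:
  fixes A :: "'a :: real_normed_field Matrix.mat"
  assumes A: "A \<in> carrier_mat n n" and n: "0 < n"
  shows "0 \<le> mat_norm2 A"
proof -
  have "unit_vec n 0 \<noteq> (0\<^sub>v n :: 'a Matrix.vec)"
    using n by (metis index_unit_vec(1) index_zero_vec(1) zero_neq_one)
  then have "0 < vec_norm2 (unit_vec n 0 :: 'a Matrix.vec)"
    by (metis index_unit_vec(3) less_eq_real_def vec_norm2_eq_0_iff vec_norm2_nonneg)
  moreover have "0 \<le> mat_norm2 A * vec_norm2 (unit_vec n 0 :: 'a Matrix.vec)"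
    by (rule order_trans[OF vec_norm2_nonneg vec_norm2_mult_le[OF A]]) auto
  ultimately show ?thesis by (simp add: zero_le_mult_iff)
qed

text \<open>\<open>mat_inverse\<close> returns an option. Invertibility makes \<open>A\<close> a
  unit of the matrix ring, which excludes \<open>None\<close>, so that \<open>the\<close> in
  \<open>mat_inv\<close> yields the inverse.\<close>

lemma mat_inv_inverts:
  fixes A :: "'a :: field Matrix.mat"
  assumes A: "A \<in> carrier_mat n n" and inv: "invertible_mat A"
  shows "mat_inv A \<in> carrier_mat n n" "A * mat_inv A = 1\<^sub>m n" "mat_inv A * A = 1\<^sub>m n"
proof -
  obtain B where B: "A * B = 1\<^sub>m n" "B * A = 1\<^sub>m (dim_row B)"
    using inv A by (auto simp: invertible_mat_def inverts_mat_def)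
  \<comment> \<open>The definition of invertibility leaves the shape of \<open>B\<close> open; it is
    read off from the two identity matrices.\<close>
  have Bc: "B \<in> carrier_mat n n"
    using arg_cong[OF B(1), of dim_col] arg_cong[OF B(2), of dim_col] A by auto
  have "A \<in> Units (ring_mat TYPE('a) n b)" for b :: bool
    using A B Bc by (auto simp: Units_def ring_mat_def)
  then obtain W where "mat_inverse A = Some W"
    using mat_inverse(1)[OF A, of True] by (cases "mat_inverse A") auto
  with mat_inverse(2)[OF A this]
  show "mat_inv A \<in> carrier_mat n n" "A * mat_inv A = 1\<^sub>m n" "mat_inv A * A = 1\<^sub>m n"
    by (auto simp: mat_inv_def)
qed

text \<open>Apply \<open>V\<close> and its inverse to a unit vector in succession. The bound later
  gives \<open>C\<^sub>R \<ge> 2\<close>, which absorbs powers of 2.\<close>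

lemma cond2_ge_1:
  fixes V :: "'a :: real_normed_field Matrix.mat"
  assumes V: "V \<in> carrier_mat n n" "invertible_mat V" and n: "0 < n"
  shows "1 \<le> cond2 V"
proof -
  let ?e = "unit_vec n 0 :: 'a Matrix.vec"
  note W = mat_inv_inverts[OF V]
  have e: "?e \<in> carrier_vec n" by simp
  have "?e \<noteq> 0\<^sub>v n"
    using n by (metis index_unit_vec(1) index_zero_vec(1) zero_neq_one)
  then have pos: "0 < vec_norm2 ?e"
    by (metis index_unit_vec(3) less_eq_real_def vec_norm2_eq_0_iff vec_norm2_nonneg)
  have "?e = V *\<^sub>v (mat_inv V *\<^sub>v ?e)"
    using assoc_mult_mat_vec[OF V(1) W(1) e] W(2) by simp
  then have "vec_norm2 ?e = vec_norm2 (V *\<^sub>v (mat_inv V *\<^sub>v ?e))" by simp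
  also have "\<dots> \<le> mat_norm2 V * vec_norm2 (mat_inv V *\<^sub>v ?e)"
    by (rule vec_norm2_mult_le[OF V(1)]) (use W in auto)
  also have "\<dots> \<le> mat_norm2 V * (mat_norm2 (mat_inv V) * vec_norm2 ?e)"
    by (intro mult_left_mono vec_norm2_mult_le[OF W(1) e] mat_norm2_nonneg[OF V(1) n])
  finally show ?thesis using pos by (simp add: cond2_def mult.assoc[symmetric])
qed

section \<open>GMRes residuals and Jordan transformations\<close>

text \<open>\<open>0 \<le> K\<close> covers the zero entries outside the blocks.\<close>

lemma norm_bound_diag_block_mat:
  fixes Bs :: "'a :: real_normed_field Matrix.mat list"
  assumes "\<And>B. B \<in> set Bs \<Longrightarrow> norm_bound B K" and "0 \<le> K"
  shows "norm_bound (diag_block_mat Bs) K"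
  using assms(1)
proof (induction Bs)
  case Nil
  then show ?case by (simp add: norm_bound_def)
next
  case (Cons B Bs)
  from Cons.prems[of B] Cons.IH Cons.prems have "norm_bound B K" "norm_bound (diag_block_mat Bs) K"
    by auto
  then show ?case using \<open>0 \<le> K\<close>
    by (auto simp: norm_bound_def Let_def index_mat_four_block(1))
qed

text \<open>The entry at distance \<open>d\<close> above the diagonal is
  \<open>(k choose d) \<mu>^(k - d)\<close>; multiplied by \<open>s^d\<close> it is dominated by one
  term of the binomial expansion of \<open>(s + \<rho>)^k\<close>. The free parameter
  \<open>s\<close> trades the rate \<open>\<rho> + s\<close> against the constant
  \<open>1 / s^(m - 1)\<close>, which serves all blocks of size at most \<open>m\<close>.\<close>

lemma norm_bound_jordan_block_pow:
  fixes \<mu> :: "'a :: real_normed_field"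
  assumes \<mu>: "norm \<mu> \<le> \<rho>" and s: "0 < s" "s \<le> 1" and n: "n \<le> m"
  shows "norm_bound (jordan_block n \<mu> ^\<^sub>m k) ((\<rho> + s) ^ k / s ^ (m - 1))"
proof (rule norm_boundI)
  have \<rho>: "0 \<le> \<rho>" using \<mu> norm_ge_zero order_trans by blast
  have pos: "0 \<le> (\<rho> + s) ^ k / s ^ (m - 1)" using \<rho> s by simp
  fix i j assume "i < dim_row (jordan_block n \<mu> ^\<^sub>m k)" "j < dim_col (jordan_block n \<mu> ^\<^sub>m k)"
  then have ij: "i < n" "j < n" unfolding jordan_block_pow_dim .
  show "norm ((jordan_block n \<mu> ^\<^sub>m k) $$ (i, j)) \<le> (\<rho> + s) ^ k / s ^ (m - 1)"
  proof (cases "i \<le> j \<and> j - i \<le> k")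
    case False
    then have "(jordan_block n \<mu> ^\<^sub>m k) $$ (i, j) = 0"
      using ij by (auto simp: jordan_block_pow binomial_eq_0)
    then show ?thesis using pos by simp
  next
    case True
    define d where "d = j - i"
    have d: "d \<le> k" "d \<le> m - 1" "k + i - j = k - d" using True ij n by (auto simp: d_def)
    have "norm ((jordan_block n \<mu> ^\<^sub>m k) $$ (i, j)) = real (k choose d) * norm \<mu> ^ (k - d)"
      using True ij d(3) by (simp add: jordan_block_pow norm_mult norm_power d_def)
    also have "\<dots> \<le> real (k choose d) * \<rho> ^ (k - d)"
      by (intro mult_left_mono power_mono \<mu>) auto
    \<comment> \<open>Powers of \<open>s \<le> 1\<close> decrease and
      \<open>d \<le> m - 1\<close>.\<close>
    also have "\<dots> * s ^ (m - 1) \<le> real (k choose d) * \<rho> ^ (k - d) * s ^ d"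
      using d s \<rho> by (intro mult_left_mono power_decreasing) auto
    also have "\<dots> \<le> (\<Sum>d\<le>k. real (k choose d) * s ^ d * \<rho> ^ (k - d))"
      using d(1) s \<rho> member_le_sum[of d "{..k}" "\<lambda>d. real (k choose d) * s ^ d * \<rho> ^ (k - d)"]
      by (simp add: mult_ac)
    also have "\<dots> = (s + \<rho>) ^ k" by (rule binomial_ring[symmetric])
    finally show ?thesis using s by (simp add: pos_le_divide_eq add.commute)
  qed
qed

text \<open>Subtracting the identity moves the eigenvalues and keeps the block sizes, so the powers
  of the shifted matrix can again be read off block by block.\<close>

lemma jordan_matrix_minus_one:
  "jordan_matrix bs - 1\<^sub>m (sum_list (map fst bs)) =
   jordan_matrix (map (\<lambda>(n, a). (n, a - 1 :: 'a :: comm_ring_1)) bs)"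
proof (induction bs)
  case Nil
  then show ?case by (auto simp: jordan_matrix_def)
next
  case (Cons b bs)
  obtain n a where b: "b = (n, a)" by force
  have dims: "sum_list (map fst (map (\<lambda>(n, a). (n, a - 1 :: 'a)) bs)) = sum_list (map fst bs)"
    by (induction bs) auto
  show ?case
    unfolding b list.map prod.case jordan_matrix_Cons Cons.IH[symmetric] dims
    by (rule eq_matI) (auto simp: b index_mat_four_block(1) jordan_block_def)
qed

section \<open>Matrix polynomials and the GMRes minimum\<close>

text \<open>Coefficients beyond the degree vanish. A common summation range allows polynomials of
  different degrees to be compared.\<close>

lemma poly_mat_altdef:
  assumes R: "R \<in> carrier_mat n n" and "degree p \<le> d" and ij: "i < n" "j < n"
  shows "poly_mat p R $$ (i, j) = (\<Sum>k\<le>d. poly.coeff p k * (R ^\<^sub>m k) $$ (i, j))"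
proof -
  have "(\<Sum>k\<le>degree p. poly.coeff p k * (R ^\<^sub>m k) $$ (i, j)) =
        (\<Sum>k\<le>d. poly.coeff p k * (R ^\<^sub>m k) $$ (i, j))"
    by (rule sum.mono_neutral_left) (use assms(2) in \<open>auto simp: coeff_eq_0\<close>)
  then show ?thesis using R ij by (simp add: poly_mat_def)
qed

lemma poly_mat_carrier: "R \<in> carrier_mat n n \<Longrightarrow> poly_mat p R \<in> carrier_mat n n"
  by (simp add: poly_mat_def)

text \<open>Induction step for the powers of \<open>x - 1\<close>: the coefficients of the product
  are differences of neighbouring coefficients of \<open>p\<close>, and an index shift turns the
  shifted half into \<open>poly_mat p R * R\<close>.\<close>

lemma poly_mat_mult_linear:
  fixes R :: "'a :: comm_ring_1 Matrix.mat"
  assumes R: "R \<in> carrier_mat n n"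
  shows "poly_mat ([:-1, 1:] * p) R = poly_mat p R * (R - 1\<^sub>m n)"
proof (rule eq_matI)
  let ?q = "[:-1, 1:] * p"
  note pc = poly_mat_carrier[OF R, of p]
  have Rk: "R ^\<^sub>m k \<in> carrier_mat n n" for k using R by auto
  fix i j assume "i < dim_row (poly_mat p R * (R - 1\<^sub>m n))" "j < dim_col (poly_mat p R * (R - 1\<^sub>m n))"
  then have ij: "i < n" "j < n" using R pc by auto
  \<comment> \<open>Only an upper bound for the degree, so that \<open>p = 0\<close> needs no
    separate treatment.\<close>
  have dq: "degree ?q \<le> Suc (degree p)"
    by (rule order_trans[OF degree_mult_le]) auto
  \<comment> \<open>The conditional is needed because \<open>k - 1\<close> is truncated at
    \<open>k = 0\<close>.\<close>
  have cq: "poly.coeff ?q k = (if k = 0 then 0 else poly.coeff p (k - 1)) - poly.coeff p k" for k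
    by (cases k) auto
  have "poly_mat ?q R $$ (i, j) =
      (\<Sum>k\<le>Suc (degree p). (if k = 0 then 0 else poly.coeff p (k - 1)) * (R ^\<^sub>m k) $$ (i, j)) -
      (\<Sum>k\<le>Suc (degree p). poly.coeff p k * (R ^\<^sub>m k) $$ (i, j))"
    unfolding poly_mat_altdef[OF R dq ij] cq by (simp add: left_diff_distrib sum_subtractf del: sum.atMost_Suc)
  also have "(\<Sum>k\<le>Suc (degree p). (if k = 0 then 0 else poly.coeff p (k - 1)) * (R ^\<^sub>m k) $$ (i, j)) =
      (\<Sum>k\<le>degree p. poly.coeff p k * (R ^\<^sub>m Suc k) $$ (i, j))"
    by (simp add: sum.atMost_Suc_shift del: sum.atMost_Suc pow_mat.simps(2))
  also have "(\<Sum>k\<le>Suc (degree p). poly.coeff p k * (R ^\<^sub>m k) $$ (i, j)) = poly_mat p R $$ (i, j)"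
    by (rule poly_mat_altdef[OF R _ ij, symmetric]) simp
  also have "(\<Sum>k\<le>degree p. poly.coeff p k * (R ^\<^sub>m Suc k) $$ (i, j)) = (poly_mat p R * R) $$ (i, j)"
  proof -
    have "(poly_mat p R * R) $$ (i, j) = (\<Sum>l<n. poly_mat p R $$ (i, l) * R $$ (l, j))"
      using ij R carrier_matD[OF pc] by (auto simp: scalar_prod_def atLeast0LessThan intro!: sum.cong)
    also have "\<dots> = (\<Sum>l<n. \<Sum>k\<le>degree p. poly.coeff p k * (R ^\<^sub>m k) $$ (i, l) * R $$ (l, j))"
      using ij by (auto simp: poly_mat_altdef[OF R order_refl] sum_distrib_right intro!: sum.cong)
    also have "\<dots> = (\<Sum>k\<le>degree p. \<Sum>l<n. poly.coeff p k * (R ^\<^sub>m k) $$ (i, l) * R $$ (l, j))"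
      by (rule sum.swap)
    also have "\<dots> = (\<Sum>k\<le>degree p. poly.coeff p k * (R ^\<^sub>m Suc k) $$ (i, j))"
    proof (rule sum.cong[OF refl])
      fix k
      show "(\<Sum>l<n. poly.coeff p k * (R ^\<^sub>m k) $$ (i, l) * R $$ (l, j)) =
            poly.coeff p k * (R ^\<^sub>m Suc k) $$ (i, j)"
        using ij R Rk[of k]
        by (auto simp: scalar_prod_def atLeast0LessThan sum_distrib_left mult.assoc intro!: sum.cong)
    qed
    finally show ?thesis by simp
  qed
  also have "(poly_mat p R * R) $$ (i, j) - poly_mat p R $$ (i, j) = (poly_mat p R * (R - 1\<^sub>m n)) $$ (i, j)"
    using mult_minus_distrib_mat[OF pc R, of "1\<^sub>m n"] R pc carrier_matD[OF pc] ij by auto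
  finally show "poly_mat ?q R $$ (i, j) = (poly_mat p R * (R - 1\<^sub>m n)) $$ (i, j)" .
qed (use R in \<open>auto simp: poly_mat_def\<close>)

lemma poly_mat_linear_power:
  fixes R :: "'a :: comm_ring_1 Matrix.mat"
  assumes R: "R \<in> carrier_mat n n"
  shows "poly_mat ([:-1, 1:] ^ k) R = (R - 1\<^sub>m n) ^\<^sub>m k"
proof (induction k)
  case 0
  show ?case using R by (auto simp: poly_mat_def intro!: eq_matI)
next
  case (Suc k)
  then show ?case using poly_mat_mult_linear[OF R, of "[:-1, 1:] ^ k"] by simp
qed

text \<open>A nonzero factor keeps the degree and hence the summation range.\<close>

lemma poly_mat_smult:
  fixes R :: "'a :: idom Matrix.mat"
  assumes R: "R \<in> carrier_mat n n" and "c \<noteq> 0"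
  shows "poly_mat (Polynomial.smult c p) R = c \<cdot>\<^sub>m poly_mat p R"
  using assms by (auto simp: poly_mat_def sum_distrib_left mult.assoc intro!: eq_matI)

text \<open>The polynomial \<open>(1 - x)^k\<close> is a competitor in the minimum that defines the
  iterates.\<close>

lemma gmres_residual_le:
  assumes R: "R \<in> carrier_mat n n" and g: "gmres_iterates R rhs v"
  shows "vec_norm2 (residual R rhs (v k)) \<le> vec_norm2 ((R - 1\<^sub>m n) ^\<^sub>m k *\<^sub>v residual R rhs (v 0))"
proof -
  \<comment> \<open>The sign turns \<open>(x - 1)^k\<close> into \<open>(1 - x)^k\<close>, which has
    the required value 1 at 0; it does not affect the norm.\<close>
  define p where "p = Polynomial.smult ((-1) ^ k) ([:-1, 1:] ^ k :: real poly)"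
  have r: "residual R rhs (v 0) \<in> carrier_vec n"
    using g R by (auto simp: gmres_iterates_def residual_def)
  have "degree p \<le> k"
    using degree_power_le[of "[:-1, 1::real:]" k] by (simp add: p_def)
  moreover have "poly p 0 = 1" by (simp add: p_def poly_power flip: power_mult_distrib)
  ultimately have "vec_norm2 (residual R rhs (v k)) \<le> vec_norm2 (poly_mat p R *\<^sub>v residual R rhs (v 0))"
    using g unfolding gmres_iterates_def Let_def by blast
  also have "poly_mat p R = (-1) ^ k \<cdot>\<^sub>m ((R - 1\<^sub>m n) ^\<^sub>m k)"
    unfolding p_def by (subst poly_mat_smult[OF R]) (simp_all add: poly_mat_linear_power[OF R])
  also have "\<dots> *\<^sub>v residual R rhs (v 0) = (-1) ^ k \<cdot>\<^sub>v ((R - 1\<^sub>m n) ^\<^sub>m k *\<^sub>v residual R rhs (v 0))"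
    using R r by (intro eq_vecI) auto
  finally show ?thesis by (simp add: vec_norm2_smult norm_power)
qed

section \<open>Jordan transformations: existence and eigenvalues\<close>

text \<open>Solves the defining equation for \<open>R\<close>, as \<open>similar_mat_wit\<close>
  expects. Comparing dimensions shows that the block sizes add up to \<open>n\<close>.\<close>

lemma jordan_transformation_wit:
  assumes R: "R \<in> carrier_mat n n" and j: "jordan_transformation R V bs"
  shows "similar_mat_wit R (jordan_matrix bs) V (mat_inv V)"
    and "sum_list (map fst bs) = n"
proof -
  have V: "V \<in> carrier_mat n n" "invertible_mat V" and J: "mat_inv V * R * V = jordan_matrix bs"
    using j R by (auto simp: jordan_transformation_def)
  note W = mat_inv_inverts[OF V]
  have "dim_row (jordan_matrix bs) = n" using V W R by (simp flip: J)
  then show n: "sum_list (map fst bs) = n" by simp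
  have "V * (mat_inv V * R * V) * mat_inv V = (V * mat_inv V) * R * (V * mat_inv V)"
    using V(1) W(1) R by (simp add: assoc_mult_mat[of _ n n _ n _ n])
  then have "R = V * jordan_matrix bs * mat_inv V" using W R J by simp
  then show "similar_mat_wit R (jordan_matrix bs) V (mat_inv V)"
    using R V W n jordan_matrix_carrier[of bs] by (auto simp: similar_mat_wit_def Let_def)
qed

text \<open>The characteristic polynomial is the product of the powers \<open>(x - a)^l\<close> over
  the blocks.\<close>

lemma jordan_transformation_eigenvalue:
  fixes R :: "complex Matrix.mat"
  assumes R: "R \<in> carrier_mat n n" and j: "jordan_transformation R V bs" and "(l, a) \<in> set bs"
  shows "eigenvalue R a"
proof -
  have "jordan_nf R bs"
    using j jordan_transformation_wit(1)[OF R j]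
    by (auto simp: jordan_nf_def jordan_transformation_def similar_mat_def)
  \<comment> \<open>A block of size zero would contribute the factor 1, which has no root.\<close>
  moreover have "l \<noteq> 0" using j assms(3) by (force simp: jordan_transformation_def)
  ultimately have "poly (char_poly R) a = 0"
    using assms(3) by (subst jordan_nf_char_poly) (force simp: poly_prod_list prod_list_zero_iff poly_power image_iff)+
  then show ?thesis using eigenvalue_root_char_poly[OF R] by simp
qed

text \<open>Over the complex numbers the characteristic polynomial splits, so a Jordan form exists.
  This serves the rate statement, which mentions no transformation.\<close>

lemma jordan_transformation_exists:
  fixes R :: "complex Matrix.mat"
  assumes R: "R \<in> carrier_mat n n"
  shows "\<exists>V bs. jordan_transformation R V bs"
proof -
  obtain as where "char_poly R = (\<Prod>a\<leftarrow>as. [:- a, 1:])" using char_poly_factorized[OF R] by auto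
  from jordan_nf_exists[OF R this] obtain bs where "jordan_nf R bs" by auto
  then obtain V W where w: "similar_mat_wit R (jordan_matrix bs) V W" and 0: "0 \<notin> fst ` set bs"
    by (auto simp: jordan_nf_def similar_mat_def)
  note D = similar_mat_witD2[OF R w]
  have inv: "invertible_mat V"
    using D by (auto simp: invertible_mat_def inverts_mat_def)
  note I = mat_inv_inverts[OF D(6) inv]
  have JW: "jordan_matrix bs * W \<in> carrier_mat n n" using D by simp
  have "mat_inv V * R = mat_inv V * (V * (jordan_matrix bs * W))"
    using D by (simp add: assoc_mult_mat[of _ n n _ n _ n])
  also have "\<dots> = jordan_matrix bs * W"
    unfolding assoc_mult_mat[OF I(1) D(6) JW, symmetric] I(3) by (rule left_mult_one_mat[OF JW])
  finally have "mat_inv V * R * V = jordan_matrix bs"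
    using D(2) assoc_mult_mat[OF D(5,7,6)] right_mult_one_mat[OF D(5)] by simp
  then show ?thesis using 0 inv D R by (auto simp: jordan_transformation_def)
qed

text \<open>In the Jordan basis the \<open>k\<close>-th power of \<open>R - I\<close> becomes that
  of the shifted Jordan matrix, whose blocks have eigenvalues of modulus at most
  \<open>\<rho>\<close>. The change of basis contributes \<open>cond2 V\<close>, the passage from
  entries to the norm contributes \<open>n\<close>.\<close>

lemma gmres_jordan_bound:
  assumes R: "R \<in> carrier_mat n n" and n: "0 < n"
    and j: "jordan_transformation (map_mat complex_of_real R) V bs"
    and g: "gmres_iterates R rhs v"
    and ev: "\<And>z. eigenvalue (map_mat complex_of_real R) z \<Longrightarrow> cmod (z - 1) \<le> \<rho>"
    and s: "0 < s" "s \<le> 1" "\<rho> + s \<le> \<theta>" and \<rho>: "0 \<le> \<rho>"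
  shows "vec_norm2 (residual R rhs (v k)) \<le>
    (real n * cond2 V / s ^ (max_block bs - 1)) * \<theta> ^ k * vec_norm2 (residual R rhs (v 0))"
proof -
  let ?R = "map_mat complex_of_real R" and ?K = "\<theta> ^ k / s ^ (max_block bs - 1)"
  let ?W = "mat_inv V"
  define r where "r = map_vec complex_of_real (residual R rhs (v 0))"
  define J where "J = jordan_matrix (map (\<lambda>(n, a). (n, a - 1)) bs)"
  have Rc: "?R \<in> carrier_mat n n" using R by simp
  have rr: "residual R rhs (v 0) \<in> carrier_vec n"
    using g R by (auto simp: gmres_iterates_def residual_def)
  then have r: "r \<in> carrier_vec n" by (simp add: r_def)
  note w = jordan_transformation_wit[OF Rc j]
  note D = similar_mat_witD2[OF Rc w(1)]
  have J: "jordan_matrix bs - 1\<^sub>m n = J" "J \<in> carrier_mat n n"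
    using jordan_matrix_minus_one[of bs] w(2) minus_carrier_mat[of "1\<^sub>m n" n n "jordan_matrix bs"]
    by (auto simp: J_def)
  have "V * (jordan_matrix bs - 1\<^sub>m n) * ?W = V * jordan_matrix bs * ?W - V * 1\<^sub>m n * ?W"
    using D by (simp add: mult_minus_distrib_mat[of _ n n] minus_mult_distrib_mat[of _ n n])
  then have "?R - 1\<^sub>m n = V * J * ?W" using D J by simp
  then have "similar_mat_wit (?R - 1\<^sub>m n) J V ?W"
    using D J by (auto simp: similar_mat_wit_def Let_def)
  then have pow: "(?R - 1\<^sub>m n) ^\<^sub>m k = V * J ^\<^sub>m k * ?W" by (rule similar_mat_wit_pow_id)
  have Jk: "J ^\<^sub>m k \<in> carrier_mat n n" using J by simp
  \<comment> \<open>The block estimate is used with \<open>\<theta> - s \<ge> \<rho>\<close> in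
    place of \<open>\<rho>\<close>, so that its rate is exactly \<open>\<theta>\<close>.\<close>
  have nb: "norm_bound (J ^\<^sub>m k) ?K" unfolding J_def jordan_matrix_pow
  proof (rule norm_bound_diag_block_mat)
    show "0 \<le> ?K" using s \<rho> by simp
    fix B assume "B \<in> set (map (\<lambda>(n, a). jordan_block n a ^\<^sub>m k) (map (\<lambda>(n, a). (n, a - 1)) bs))"
    then obtain l a where la: "(l, a) \<in> set bs" "B = jordan_block l (a - 1) ^\<^sub>m k" by auto
    have "l \<le> max_block bs" unfolding max_block_def using la by (intro Max_ge) force+
    moreover have "cmod (a - 1) \<le> \<rho>" using ev jordan_transformation_eigenvalue[OF Rc j la(1)] by simp
    moreover have "\<rho> \<le> \<theta> - s" using s by simp
    ultimately show "norm_bound B ?K"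
      using norm_bound_jordan_block_pow[of "a - 1" "\<theta> - s" s l "max_block bs" k] la(2) s(1,2)
      by simp
  qed
  have "vec_norm2 (residual R rhs (v k)) \<le> vec_norm2 ((R - 1\<^sub>m n) ^\<^sub>m k *\<^sub>v residual R rhs (v 0))"
    by (rule gmres_residual_le[OF R g])
  \<comment> \<open>The residuals are real but the Jordan form is complex; the embedding of the
    reals commutes with the matrix operations and preserves the norm.\<close>
  also have "\<dots> = vec_norm2 ((?R - 1\<^sub>m n) ^\<^sub>m k *\<^sub>v r)"
  proof -
    have "map_mat complex_of_real (R - 1\<^sub>m n) = ?R - 1\<^sub>m n"
      using R by (auto intro!: eq_matI)
    moreover have "map_mat complex_of_real ((R - 1\<^sub>m n) ^\<^sub>m k) = map_mat complex_of_real (R - 1\<^sub>m n) ^\<^sub>m k"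
      by (rule of_real_hom.mat_hom_pow[of _ n]) (use R in auto)
    ultimately have "map_mat complex_of_real ((R - 1\<^sub>m n) ^\<^sub>m k) = (?R - 1\<^sub>m n) ^\<^sub>m k"
      by simp
    moreover have "map_vec complex_of_real ((R - 1\<^sub>m n) ^\<^sub>m k *\<^sub>v residual R rhs (v 0)) =
        map_mat complex_of_real ((R - 1\<^sub>m n) ^\<^sub>m k) *\<^sub>v r"
      unfolding r_def by (rule of_real_hom.mult_mat_vec_hom[of _ n n]) (use R rr in auto)
    ultimately show ?thesis by (metis vec_norm2_map_of_real)
  qed
  also have "(?R - 1\<^sub>m n) ^\<^sub>m k *\<^sub>v r = V *\<^sub>v (J ^\<^sub>m k *\<^sub>v (?W *\<^sub>v r))"
    unfolding pow using assoc_mult_mat_vec[OF mult_carrier_mat[OF D(6) Jk] D(7) r]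
      assoc_mult_mat_vec[OF D(6) Jk mult_mat_vec_carrier[OF D(7) r]] by (rule trans)
  also have "vec_norm2 \<dots> \<le> mat_norm2 V * (real n * ?K * (mat_norm2 ?W * vec_norm2 r))"
  proof -
    have 1: "vec_norm2 (?W *\<^sub>v r) \<le> mat_norm2 ?W * vec_norm2 r"
      by (rule vec_norm2_mult_le[OF D(7) r])
    have "vec_norm2 (J ^\<^sub>m k *\<^sub>v (?W *\<^sub>v r)) \<le> real n * ?K * vec_norm2 (?W *\<^sub>v r)"
      by (rule vec_norm2_mult_entries_le[OF Jk _ nb]) (use D r in auto)
    also have "\<dots> \<le> real n * ?K * (mat_norm2 ?W * vec_norm2 r)"
      using s \<rho> by (intro mult_left_mono 1) auto
    finally have 2: "vec_norm2 (J ^\<^sub>m k *\<^sub>v (?W *\<^sub>v r)) \<le> real n * ?K * (mat_norm2 ?W * vec_norm2 r)" .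
    have "vec_norm2 (V *\<^sub>v (J ^\<^sub>m k *\<^sub>v (?W *\<^sub>v r))) \<le> mat_norm2 V * vec_norm2 (J ^\<^sub>m k *\<^sub>v (?W *\<^sub>v r))"
      by (rule vec_norm2_mult_le[OF D(6)]) (use D Jk r in auto)
    also have "\<dots> \<le> mat_norm2 V * (real n * ?K * (mat_norm2 ?W * vec_norm2 r))"
      by (intro mult_left_mono 2 mat_norm2_nonneg[OF D(6) n])
    finally show ?thesis .
  qed
  also have "\<dots> = (real n * cond2 V / s ^ (max_block bs - 1)) * \<theta> ^ k * vec_norm2 r"
    by (simp add: cond2_def)
  also have "vec_norm2 r = vec_norm2 (residual R rhs (v 0))"
    by (simp add: r_def vec_norm2_map_of_real)
  finally show ?thesis .
qed

section \<open>The saddle point pencil\<close>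

text \<open>Conjugate linear in the first argument. Arguments are functions on indices rather than
  vectors, so that both halves of a vector of length \<open>2 * N\<close> can be inserted
  directly.\<close>

definition sesq :: "nat \<Rightarrow> (nat \<Rightarrow> nat \<Rightarrow> real) \<Rightarrow> (nat \<Rightarrow> complex) \<Rightarrow> (nat \<Rightarrow> complex) \<Rightarrow> complex" where
  "sesq N X u v = (\<Sum>i<N. \<Sum>j<N. cnj (u i) * complex_of_real (X i j) * v j)"

definition quad :: "nat \<Rightarrow> (nat \<Rightarrow> nat \<Rightarrow> real) \<Rightarrow> (nat \<Rightarrow> real) \<Rightarrow> real" where
  "quad N X p = (\<Sum>i<N. \<Sum>j<N. p i * X i j * p j)"

definition symm_on :: "nat \<Rightarrow> (nat \<Rightarrow> nat \<Rightarrow> real) \<Rightarrow> bool" where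
  "symm_on N X \<longleftrightarrow> (\<forall>i<N. \<forall>j<N. X i j = X j i)"

lemma cnj_sesq:
  assumes "symm_on N X"
  shows "cnj (sesq N X u v) = sesq N X v u"
proof -
  have "cnj (sesq N X u v) = (\<Sum>i<N. \<Sum>j<N. cnj (v j) * complex_of_real (X j i) * u i)"
    unfolding sesq_def cnj_sum
  proof (intro sum.cong refl)
    fix i j assume "i \<in> {..<N}" "j \<in> {..<N}"
    then have "X i j = X j i" using assms unfolding symm_on_def by blast
    then show "cnj (cnj (u i) * complex_of_real (X i j) * v j) = cnj (v j) * complex_of_real (X j i) * u i"
      by simp
  qed
  also have "\<dots> = sesq N X v u" unfolding sesq_def by (rule sum.swap)
  finally show ?thesis .
qed

text \<open>The mixed products of real and imaginary parts carry a factor \<open>\<i>\<close>. This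
  reduces complex positivity to the real quadratic form.\<close>

lemma Re_sesq_self: "Re (sesq N X u u) = quad N X (\<lambda>i. Re (u i)) + quad N X (\<lambda>i. Im (u i))"
  unfolding sesq_def quad_def Re_sum sum.distrib[symmetric]
  by (intro sum.cong refl) (simp add: algebra_simps)

lemma sesq_self:
  assumes "symm_on N X"
  shows "sesq N X u u = complex_of_real (Re (sesq N X u u))"
proof -
  have "Im (sesq N X u u) = 0"
    using arg_cong[OF cnj_sesq[OF assms, of u u], of Im] by simp
  then show ?thesis by (simp add: complex_eq_iff)
qed

lemma sesq_scale_left: "sesq N X (\<lambda>i. c * u i) v = cnj c * sesq N X u v"
  by (simp add: sesq_def sum_distrib_left mult_ac)

lemma sesq_scale_right: "sesq N X u (\<lambda>i. c * v i) = c * sesq N X u v"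
  by (simp add: sesq_def sum_distrib_left mult_ac)

lemma sesq_diff:
  "sesq N X (\<lambda>i. u i - v i) (\<lambda>i. u i - v i) = sesq N X u u - sesq N X u v - sesq N X v u + sesq N X v v"
  unfolding sesq_def sum_subtractf[symmetric] sum.distrib[symmetric]
  by (intro sum.cong refl) (simp add: algebra_simps)

text \<open>Cauchy-Schwarz in its arithmetic mean form: rotate \<open>u\<close> by a phase until its
  product with \<open>v\<close> is the modulus, then expand the nonnegative form at the difference
  of the two vectors.\<close>

lemma norm_sesq_le:
  assumes sym: "symm_on N X" and nonneg: "\<And>p. 0 \<le> quad N X p"
  shows "cmod (sesq N X u v) \<le> (Re (sesq N X u u) + Re (sesq N X v v)) / 2"
proof -
  define z where "z = sesq N X u v"
  \<comment> \<open>The phase of \<open>z\<close>, which conjugate linearity in the first argument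
    cancels; for \<open>z = 0\<close> any number of modulus 1 would do.\<close>
  define \<omega> where "\<omega> = (if z = 0 then 1 else z / cmod z)"
  have \<omega>: "cnj \<omega> * \<omega> = 1" "cnj \<omega> * z = complex_of_real (cmod z)"
    by (auto simp: \<omega>_def complex_norm_square[symmetric] mult.commute[of "cnj z"] power2_eq_square)
  define u' where "u' = (\<lambda>i. \<omega> * u i)"
  have uv: "sesq N X u' v = complex_of_real (cmod z)"
    by (simp add: u'_def sesq_scale_left \<omega> flip: z_def)
  have vu: "sesq N X v u' = complex_of_real (cmod z)"
    using cnj_sesq[OF sym, of u' v] uv by simp
  have uu: "sesq N X u' u' = sesq N X u u"
    using \<omega>(1) by (simp add: u'_def sesq_scale_left sesq_scale_right mult.assoc[symmetric])
  have "0 \<le> Re (sesq N X (\<lambda>i. u' i - v i) (\<lambda>i. u' i - v i))"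
    unfolding Re_sesq_self using nonneg by (intro add_nonneg_nonneg)
  then have "2 * cmod z \<le> Re (sesq N X u u) + Re (sesq N X v v)"
    unfolding sesq_diff uv vu uu by simp
  then show ?thesis by (simp add: z_def)
qed

lemma sesq_pos:
  assumes "\<And>p. 0 \<le> quad N X p" "\<And>p. quad N X p = 0 \<Longrightarrow> \<forall>i<N. p i = 0"
  shows "0 \<le> Re (sesq N X u u)" "Re (sesq N X u u) = 0 \<Longrightarrow> \<forall>i<N. u i = 0"
proof -
  show "0 \<le> Re (sesq N X u u)" unfolding Re_sesq_self by (intro add_nonneg_nonneg assms)
  assume "Re (sesq N X u u) = 0"
  then have "quad N X (\<lambda>i. Re (u i)) = 0" "quad N X (\<lambda>i. Im (u i)) = 0"
    unfolding Re_sesq_self using assms(1)[of "\<lambda>i. Re (u i)"] assms(1)[of "\<lambda>i. Im (u i)"] by auto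
  with assms(2) show "\<forall>i<N. u i = 0" by (auto simp: complex_eq_iff)
qed

section \<open>Block rows of the saddle point matrices\<close>

lemma sum_lessThan_add:
  fixes f :: "nat \<Rightarrow> 'a :: comm_monoid_add"
  shows "(\<Sum>j<n + m. f j) = (\<Sum>j<n. f j) + (\<Sum>j<m. f (n + j))"
  by (induction m) (auto simp: add.assoc)

lemma saddle_matrix_carrier:
  assumes "A \<in> carrier_mat N N" "B \<in> carrier_mat N N"
  shows "saddle_matrix \<tau> A B M \<in> carrier_mat (2 * N) (2 * N)"
  using assms by (auto simp: saddle_matrix_def mult_2)

lemma saddle_matrix_mult_vec:
  fixes \<tau> :: real
  assumes A: "A \<in> carrier_mat N N" and B: "B \<in> carrier_mat N N" and M: "M \<in> carrier_mat N N"
    and y: "y \<in> carrier_vec (2 * N)" and i: "i < N"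
  defines "S \<equiv> map_mat complex_of_real (saddle_matrix \<tau> A B M)"
  shows "vec_index (S *\<^sub>v y) i =
      \<tau> * (\<Sum>j<N. A $$ (i, j) * vec_index y j) + (\<Sum>j<N. M $$ (i, j) * vec_index y (N + j))"
    and "vec_index (S *\<^sub>v y) (N + i) =
      (\<Sum>j<N. M $$ (i, j) * vec_index y j) - \<tau> * (\<Sum>j<N. B $$ (i, j) * vec_index y (N + j))"
proof -
  note c = saddle_matrix_carrier[OF A B, of \<tau> M]
  have *: "vec_index (S *\<^sub>v y) k = (\<Sum>j<N + N. S $$ (k, j) * vec_index y j)" if "k < 2 * N" for k
    using that c y by (auto simp: S_def scalar_prod_def atLeast0LessThan mult_2[symmetric] intro!: sum.cong)
  have S: "S $$ (k, j) = complex_of_real (saddle_matrix \<tau> A B M $$ (k, j))" if "k < 2 * N" "j < 2 * N" for k j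
    using that c by (simp add: S_def)
  show "vec_index (S *\<^sub>v y) i =
      \<tau> * (\<Sum>j<N. A $$ (i, j) * vec_index y j) + (\<Sum>j<N. M $$ (i, j) * vec_index y (N + j))"
    using i A B M by (simp add: * S sum_lessThan_add sum_distrib_left saddle_matrix_def mult.assoc)
  show "vec_index (S *\<^sub>v y) (N + i) =
      (\<Sum>j<N. M $$ (i, j) * vec_index y j) - \<tau> * (\<Sum>j<N. B $$ (i, j) * vec_index y (N + j))"
    using i A B M by (simp add: * S sum_lessThan_add sum_distrib_left saddle_matrix_def mult.assoc sum_negf)
qed

lemma sum_cnj_sesq:
  "(\<Sum>i<N. cnj (u i) * (\<Sum>j<N. complex_of_real (X i j) * v j)) = sesq N X u v"
  by (simp add: sesq_def sum_distrib_left mult.assoc)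

lemma sesq_diff_matrix: "sesq N (\<lambda>i j. X i j - Y i j) u v = sesq N X u v - sesq N Y u v"
  unfolding sesq_def sum_subtractf[symmetric]
  by (intro sum.cong refl) (simp add: algebra_simps)

text \<open>The two block rows are tested separately with the same arbitrary \<open>w\<close>, which
  is later one of the halves of \<open>y\<close>.\<close>

lemma saddle_matrix_sesq:
  fixes \<tau> :: real
  assumes A: "A \<in> carrier_mat N N" and B: "B \<in> carrier_mat N N" and M: "M \<in> carrier_mat N N"
    and y: "y \<in> carrier_vec (2 * N)"
  defines "S \<equiv> map_mat complex_of_real (saddle_matrix \<tau> A B M)"
    and "v \<equiv> (\<lambda>i. vec_index y (N + i))"
  shows "(\<Sum>i<N. cnj (w i) * vec_index (S *\<^sub>v y) i) =
      \<tau> * sesq N (\<lambda>i j. A $$ (i, j)) w (vec_index y) + sesq N (\<lambda>i j. M $$ (i, j)) w v"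
    and "(\<Sum>i<N. cnj (w i) * vec_index (S *\<^sub>v y) (N + i)) =
      sesq N (\<lambda>i j. M $$ (i, j)) w (vec_index y) - \<tau> * sesq N (\<lambda>i j. B $$ (i, j)) w v"
proof -
  note S = saddle_matrix_mult_vec[OF A B M y, of _ \<tau>, folded S_def]
  show "(\<Sum>i<N. cnj (w i) * vec_index (S *\<^sub>v y) i) =
      \<tau> * sesq N (\<lambda>i j. A $$ (i, j)) w (vec_index y) + sesq N (\<lambda>i j. M $$ (i, j)) w v"
    unfolding sum_cnj_sesq[symmetric] sum_distrib_left[of "complex_of_real \<tau>"] sum.distrib[symmetric]
    by (intro sum.cong refl) (simp add: S v_def distrib_left mult.left_commute[of _ "complex_of_real \<tau>"])
  show "(\<Sum>i<N. cnj (w i) * vec_index (S *\<^sub>v y) (N + i)) =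
      sesq N (\<lambda>i j. M $$ (i, j)) w (vec_index y) - \<tau> * sesq N (\<lambda>i j. B $$ (i, j)) w v"
    unfolding sum_cnj_sesq[symmetric] sum_distrib_left[of "complex_of_real \<tau>"] sum_subtractf[symmetric]
    by (intro sum.cong refl) (simp add: S v_def right_diff_distrib mult.left_commute[of _ "complex_of_real \<tau>"])
qed

section \<open>Spectrum of the preconditioned matrices\<close>

text \<open>The algebraic content of the finite element setting: \<open>D\<close> stands for the
  lumped mass matrix, and \<open>\<epsilon>\<close> compares the lumping defect with both scaled
  stiffness energies. It becomes the bound for the distance of the eigenvalues from 1.\<close>

locale saddle_pair =
  fixes N :: nat and A B M D :: "real Matrix.mat" and \<tau> \<epsilon> :: real
  assumes carrier: "A \<in> carrier_mat N N" "B \<in> carrier_mat N N" "M \<in> carrier_mat N N" "D \<in> carrier_mat N N"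
    and sym: "symm_on N (\<lambda>i j. A $$ (i, j))" "symm_on N (\<lambda>i j. B $$ (i, j))"
      "symm_on N (\<lambda>i j. M $$ (i, j))" "symm_on N (\<lambda>i j. D $$ (i, j))"
    and posA: "\<And>p. 0 \<le> quad N (\<lambda>i j. A $$ (i, j)) p"
      "\<And>p. quad N (\<lambda>i j. A $$ (i, j)) p = 0 \<Longrightarrow> \<forall>i<N. p i = 0"
    and posB: "\<And>p. 0 \<le> quad N (\<lambda>i j. B $$ (i, j)) p"
      "\<And>p. quad N (\<lambda>i j. B $$ (i, j)) p = 0 \<Longrightarrow> \<forall>i<N. p i = 0"
    and defect_nonneg: "\<And>p. 0 \<le> quad N (\<lambda>i j. D $$ (i, j) - M $$ (i, j)) p"
    and defect_A: "\<And>p. quad N (\<lambda>i j. D $$ (i, j) - M $$ (i, j)) p \<le> \<epsilon> * (\<tau> * quad N (\<lambda>i j. A $$ (i, j)) p)"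
    and defect_B: "\<And>p. quad N (\<lambda>i j. D $$ (i, j) - M $$ (i, j)) p \<le> \<epsilon> * (\<tau> * quad N (\<lambda>i j. B $$ (i, j)) p)"
    and tau: "0 < \<tau>"
begin

abbreviation "S \<equiv> saddle_matrix \<tau> A B M"
abbreviation "P \<equiv> saddle_matrix \<tau> A B D"
abbreviation "cS \<equiv> map_mat complex_of_real S"
abbreviation "cP \<equiv> map_mat complex_of_real P"

text \<open>If both energies vanish, definiteness kills both halves of \<open>y\<close>. The energy
  is the quantity to divide by in the eigenvalue estimate.\<close>

lemma energy_pos:
  assumes "y \<in> carrier_vec (2 * N)" "y \<noteq> 0\<^sub>v (2 * N)"
  shows "0 < \<tau> * Re (sesq N (\<lambda>i j. A $$ (i, j)) (vec_index y) (vec_index y)) +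
      \<tau> * Re (sesq N (\<lambda>i j. B $$ (i, j)) (\<lambda>i. vec_index y (N + i)) (\<lambda>i. vec_index y (N + i)))"
    (is "0 < \<tau> * ?a + \<tau> * ?b")
proof (rule ccontr)
  note a = sesq_pos[OF posA, of "vec_index y"]
  note b = sesq_pos[OF posB, of "\<lambda>i. vec_index y (N + i)"]
  assume "\<not> ?thesis"
  then have "\<not> 0 < \<tau> * (?a + ?b)" by (simp only: distrib_left not_False_eq_True)
  then have "?a + ?b \<le> 0" using tau by (simp add: zero_less_mult_iff)
  with a(1) b(1) have ab: "?a = 0" "?b = 0" by linarith+
  note 0 = a(2)[OF _ ab(1)] b(2)[OF _ ab(2)]
  have "vec_index y k = 0" if "k < 2 * N" for k
    using 0(1)[rule_format, of k] 0(2)[rule_format, of "k - N"] that by (cases "k < N") simp_all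
  then have "y = 0\<^sub>v (2 * N)" using assms(1) by (intro eq_vecI) auto
  with assms(2) show False by simp
qed

text \<open>The two tested rows express the same number \<open>x\<close>, the defect form at
  \<open>(u, v)\<close>, once through \<open>\<mu>\<close> and once through its conjugate. Together
  they bound \<open>\<mu>\<close> times the energy by \<open>2 * cmod x\<close>, which is at most
  the defect energies of \<open>u\<close> and \<open>v\<close>, hence at most
  \<open>\<epsilon>\<close> times the energy.\<close>

lemma pencil_eigenvalue_near_1:
  assumes y: "y \<in> carrier_vec (2 * N)" "y \<noteq> 0\<^sub>v (2 * N)" and eq: "cS *\<^sub>v y = z \<cdot>\<^sub>v (cP *\<^sub>v y)"
  shows "cmod (z - 1) \<le> \<epsilon>"
proof (cases "z = 1")
  case True
  \<comment> \<open>Here the claim is \<open>0 \<le> \<epsilon>\<close>. It follows since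
    \<open>\<epsilon>\<close> times a positive energy dominates nonnegative defects.\<close>
  have "0 \<le> \<epsilon> * (\<tau> * (Re (sesq N (\<lambda>i j. A $$ (i, j)) (vec_index y) (vec_index y))) +
      \<tau> * Re (sesq N (\<lambda>i j. B $$ (i, j)) (\<lambda>i. vec_index y (N + i)) (\<lambda>i. vec_index y (N + i))))"
    using order_trans[OF defect_nonneg defect_A] order_trans[OF defect_nonneg defect_B]
    unfolding Re_sesq_self distrib_left by (intro add_nonneg_nonneg) auto
  then show ?thesis using energy_pos[OF y] True by (simp add: zero_le_mult_iff)
next
  case False
  let ?A = "\<lambda>i j. A $$ (i, j)" and ?B = "\<lambda>i j. B $$ (i, j)"
    and ?M = "\<lambda>i j. M $$ (i, j)" and ?D = "\<lambda>i j. D $$ (i, j)"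
  let ?X = "\<lambda>i j. D $$ (i, j) - M $$ (i, j)"
  define u where "u = vec_index y"
  define v where "v = (\<lambda>i. vec_index y (N + i))"
  define a where "a = Re (sesq N ?A u u)"
  define b where "b = Re (sesq N ?B v v)"
  define \<mu> where "\<mu> = z - 1"
  have \<mu>: "\<mu> \<noteq> 0" using False by (simp add: \<mu>_def)
  define x where "x = sesq N ?X u v"
  define d where "d = sesq N ?D u v"
  note cP = saddle_matrix_carrier[OF carrier(1,2), of \<tau> D]
  have aA: "sesq N ?A u u = a" unfolding a_def by (rule sesq_self[OF sym(1)])
  have bB: "sesq N ?B v v = b" unfolding b_def by (rule sesq_self[OF sym(2)])
  have symX: "symm_on N ?X" using sym(3,4) by (simp add: symm_on_def)
  have e: "vec_index (cS *\<^sub>v y) k = z * vec_index (cP *\<^sub>v y) k" if "k < 2 * N" for k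
    unfolding eq using that cP by simp
  have "(\<Sum>i<N. cnj (u i) * vec_index (cS *\<^sub>v y) i) = z * (\<Sum>i<N. cnj (u i) * vec_index (cP *\<^sub>v y) i)"
    by (simp add: e sum_distrib_left mult_ac)
  then have "\<tau> * sesq N ?A u u + sesq N ?M u v = z * (\<tau> * sesq N ?A u u + sesq N ?D u v)"
    unfolding saddle_matrix_sesq[OF carrier(1,2,3) y(1)] saddle_matrix_sesq[OF carrier(1,2,4) y(1)]
    by (simp add: u_def v_def)
  then have 1: "x = - \<mu> * (\<tau> * a + d)"
    by (simp add: x_def sesq_diff_matrix aA d_def \<mu>_def algebra_simps)
  have "(\<Sum>i<N. cnj (v i) * vec_index (cS *\<^sub>v y) (N + i)) = z * (\<Sum>i<N. cnj (v i) * vec_index (cP *\<^sub>v y) (N + i))"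
    by (simp add: e sum_distrib_left mult_ac)
  then have "sesq N ?M v u - \<tau> * sesq N ?B v v = z * (sesq N ?D v u - \<tau> * sesq N ?B v v)"
    unfolding saddle_matrix_sesq[OF carrier(1,2,3) y(1)] saddle_matrix_sesq[OF carrier(1,2,4) y(1)]
    by (simp add: u_def v_def)
  then have "sesq N ?X v u = - \<mu> * (sesq N ?D v u - \<tau> * b)"
    by (simp add: sesq_diff_matrix bB \<mu>_def algebra_simps)
  \<comment> \<open>Conjugation exchanges the arguments of the Hermitian forms, so the second row
    also speaks of \<open>x\<close> and \<open>d\<close>.\<close>
  then have "cnj (sesq N ?X v u) = - cnj \<mu> * (cnj (sesq N ?D v u) - \<tau> * b)"
    by simp
  then have 2: "x = - cnj \<mu> * (d - \<tau> * b)"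
    by (simp add: cnj_sesq[OF symX] cnj_sesq[OF sym(4)] x_def d_def)
  \<comment> \<open>Dividing the equations by \<open>\<mu>\<close> and its conjugate and subtracting
    cancels \<open>d\<close>, for which no bound is available.\<close>
  have "complex_of_real (\<tau> * a + \<tau> * b) = x / cnj \<mu> - x / \<mu>"
    by (subst (1) 2, subst 1) (use \<mu> in simp)
  moreover have pos: "0 < \<tau> * a + \<tau> * b"
    unfolding a_def b_def u_def v_def by (rule energy_pos[OF y])
  ultimately have "\<tau> * a + \<tau> * b = cmod (x / cnj \<mu> - x / \<mu>)"
    by (metis abs_of_pos norm_of_real)
  also have "\<dots> \<le> cmod x / cmod \<mu> + cmod x / cmod \<mu>"
    by (rule order_trans[OF norm_triangle_ineq4]) (simp add: norm_divide)
  finally have "(\<tau> * a + \<tau> * b) * cmod \<mu> \<le> 2 * cmod x"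
    using \<mu> by (simp add: field_simps)
  also have "\<dots> \<le> Re (sesq N ?X u u) + Re (sesq N ?X v v)"
    using norm_sesq_le[OF symX defect_nonneg, of u v] by (simp add: x_def)
  also have "\<dots> \<le> \<epsilon> * (\<tau> * a) + \<epsilon> * (\<tau> * b)"
    unfolding Re_sesq_self a_def b_def distrib_left by (intro add_mono defect_A defect_B)
  finally have "(\<tau> * a + \<tau> * b) * cmod \<mu> \<le> (\<tau> * a + \<tau> * b) * \<epsilon>" by (simp add: algebra_simps)
  then show ?thesis
    using pos by (simp add: \<mu>_def)
qed

text \<open>A kernel vector is tested in the same way: after conjugation of the second row the
  lumped terms have equal real parts, so subtracting leaves zero energy.\<close>

lemma invertible_P: "invertible_mat P"
proof -
  let ?A = "\<lambda>i j. A $$ (i, j)" and ?B = "\<lambda>i j. B $$ (i, j)" and ?D = "\<lambda>i j. D $$ (i, j)"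
  note cP = saddle_matrix_carrier[OF carrier(1,2), of \<tau> D]
  have "y = 0\<^sub>v (2 * N)" if y: "y \<in> carrier_vec (2 * N)" and eq: "cP *\<^sub>v y = 0\<^sub>v (2 * N)" for y
  proof (rule ccontr)
    assume "y \<noteq> 0\<^sub>v (2 * N)"
    note pos = energy_pos[OF y this]
    define u where "u = vec_index y"
    define v where "v = (\<lambda>i. vec_index y (N + i))"
    have e: "vec_index (cP *\<^sub>v y) k = 0" if "k < 2 * N" for k unfolding eq using that by simp
    have "(\<Sum>i<N. cnj (u i) * vec_index (cP *\<^sub>v y) i) = 0" by (simp add: e)
    then have 1: "\<tau> * sesq N ?A u u + sesq N ?D u v = 0"
      unfolding saddle_matrix_sesq[OF carrier(1,2,4) y] by (simp add: u_def v_def)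
    have "(\<Sum>i<N. cnj (v i) * vec_index (cP *\<^sub>v y) (N + i)) = 0" by (simp add: e)
    then have "sesq N ?D v u - \<tau> * sesq N ?B v v = 0"
      unfolding saddle_matrix_sesq[OF carrier(1,2,4) y] by (simp add: u_def v_def)
    then have 2: "cnj (sesq N ?D u v) - \<tau> * sesq N ?B v v = 0" by (simp add: cnj_sesq[OF sym(4)])
    from 1 2 have "\<tau> * Re (sesq N ?A u u) + \<tau> * Re (sesq N ?B v v) = 0"
      by (simp add: complex_eq_iff)
    with pos show False by (simp add: u_def v_def)
  qed
  \<comment> \<open>The kernel is trivial over the complex numbers; the determinant carries this
    back to the real matrix.\<close>
  then have "Determinant.det cP \<noteq> 0"
    using det_0_iff_vec_prod_zero[of cP "2 * N"] cP by auto
  then have "Determinant.det P \<noteq> 0" by (simp add: of_real_hom.hom_det)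
  moreover have P: "P \<in> carrier_mat (2 * N) (2 * N)" by (rule saddle_matrix_carrier[OF carrier(1,2)])
  ultimately have "P \<in> Units (ring_mat TYPE(real) (2 * N) ())" by (intro det_non_zero_imp_unit)
  then obtain W where "W \<in> carrier_mat (2 * N) (2 * N)" "W * P = 1\<^sub>m (2 * N)" "P * W = 1\<^sub>m (2 * N)"
    by (auto simp: Units_def ring_mat_def)
  then show ?thesis using P unfolding invertible_mat_def inverts_mat_def by auto
qed

abbreviation "W \<equiv> mat_inv P"

lemma carriers: "S \<in> carrier_mat (2 * N) (2 * N)" "P \<in> carrier_mat (2 * N) (2 * N)"
  by (rule saddle_matrix_carrier[OF carrier(1,2)])+

lemmas P_inv = mat_inv_inverts[OF carriers(2) invertible_P]

lemma complex_inverse: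
  "map_mat complex_of_real W \<in> carrier_mat (2 * N) (2 * N)"
  "cP * map_mat complex_of_real W = 1\<^sub>m (2 * N)"
proof -
  show "map_mat complex_of_real W \<in> carrier_mat (2 * N) (2 * N)" using P_inv(1) by simp
  have "cP * map_mat complex_of_real W = map_mat complex_of_real (P * W)"
    by (rule of_real_hom.mat_hom_mult[OF carriers(2) P_inv(1), symmetric])
  then show "cP * map_mat complex_of_real W = 1\<^sub>m (2 * N)"
    unfolding P_inv(2) of_real_hom.mat_hom_one .
qed

text \<open>An eigenvector \<open>x\<close> of \<open>S * W\<close> gives the pencil vector
  \<open>y = W x\<close>, because \<open>P y = x\<close>. This matrix is the one GMRes works
  with.\<close>

lemma right_eigenvalue_near_1:
  assumes "eigenvalue (map_mat complex_of_real (S * W)) z"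
  shows "cmod (z - 1) \<le> \<epsilon>"
proof -
  let ?W = "map_mat complex_of_real W"
  have c: "cS \<in> carrier_mat (2 * N) (2 * N)" "cP \<in> carrier_mat (2 * N) (2 * N)" using carriers by auto
  have "map_mat complex_of_real (S * W) = cS * ?W"
    by (rule of_real_hom.mat_hom_mult[OF carriers(1) P_inv(1)])
  with assms obtain x where x: "x \<in> carrier_vec (2 * N)" "x \<noteq> 0\<^sub>v (2 * N)" "(cS * ?W) *\<^sub>v x = z \<cdot>\<^sub>v x"
    using carriers by (auto simp: eigenvalue_def eigenvector_def)
  define y where "y = ?W *\<^sub>v x"
  have y: "y \<in> carrier_vec (2 * N)" unfolding y_def by (rule mult_mat_vec_carrier[OF complex_inverse(1) x(1)])
  have Sy: "cS *\<^sub>v y = z \<cdot>\<^sub>v x"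
    using assoc_mult_mat_vec[OF c(1) complex_inverse(1) x(1)] x(3) by (simp add: y_def)
  have Py: "cP *\<^sub>v y = x"
    using assoc_mult_mat_vec[OF c(2) complex_inverse(1) x(1)] x(1) complex_inverse(2) by (simp add: y_def)
  have "y \<noteq> 0\<^sub>v (2 * N)"
  proof
    assume "y = 0\<^sub>v (2 * N)"
    then have "cP *\<^sub>v y = 0\<^sub>v (2 * N)" using c(2) by (auto intro!: eq_vecI)
    then show False using Py x(2) by simp
  qed
  then show ?thesis using pencil_eigenvalue_near_1[OF y] Sy Py by simp
qed

text \<open>Here the eigenvector itself solves the pencil, after multiplication by \<open>P\<close>.
  This matrix defines \<open>\<theta>\<close>.\<close>

lemma left_eigenvalue_near_1:
  assumes "eigenvalue (map_mat complex_of_real (W * S)) z"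
  shows "cmod (z - 1) \<le> \<epsilon>"
proof -
  let ?W = "map_mat complex_of_real W"
  have c: "cS \<in> carrier_mat (2 * N) (2 * N)" "cP \<in> carrier_mat (2 * N) (2 * N)" using carriers by auto
  have WS: "map_mat complex_of_real (W * S) = ?W * cS"
    by (rule of_real_hom.mat_hom_mult[OF P_inv(1) carriers(1)])
  with assms obtain y where y: "y \<in> carrier_vec (2 * N)" "y \<noteq> 0\<^sub>v (2 * N)" "(?W * cS) *\<^sub>v y = z \<cdot>\<^sub>v y"
    using P_inv(1) by (auto simp: eigenvalue_def eigenvector_def)
  have Sy: "cS *\<^sub>v y \<in> carrier_vec (2 * N)" by (rule mult_mat_vec_carrier[OF c(1) y(1)])
  have "cS *\<^sub>v y = (cP * ?W) *\<^sub>v (cS *\<^sub>v y)" using complex_inverse(2) Sy by simp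
  also have "\<dots> = cP *\<^sub>v (?W *\<^sub>v (cS *\<^sub>v y))" by (rule assoc_mult_mat_vec[OF c(2) complex_inverse(1) Sy])
  also have "?W *\<^sub>v (cS *\<^sub>v y) = z \<cdot>\<^sub>v y" using assoc_mult_mat_vec[OF complex_inverse(1) c(1) y(1)] y(3) by simp
  also have "cP *\<^sub>v (z \<cdot>\<^sub>v y) = z \<cdot>\<^sub>v (cP *\<^sub>v y)" by (rule mult_mat_vec[OF c(2) y(1)])
  finally show ?thesis by (rule pencil_eigenvalue_near_1[OF y(1,2)])
qed

text \<open>Adding the identity moves the eigenvalue \<open>z\<close> to
  \<open>z + 1\<close>.\<close>

lemma error_eigenvalue_le:
  assumes "eigenvalue (map_mat complex_of_real (W * S - 1\<^sub>m (2 * N))) z"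
  shows "cmod z \<le> \<epsilon>"
proof -
  let ?L = "map_mat complex_of_real (W * S)"
  have WS: "W * S \<in> carrier_mat (2 * N) (2 * N)" by (rule mult_carrier_mat[OF P_inv(1) carriers(1)])
  then have L: "?L \<in> carrier_mat (2 * N) (2 * N)" by simp
  have E: "map_mat complex_of_real (W * S - 1\<^sub>m (2 * N)) = ?L - 1\<^sub>m (2 * N)"
    using carrier_matD[OF WS] by (intro eq_matI) auto
  obtain y where y: "y \<in> carrier_vec (2 * N)" "y \<noteq> 0\<^sub>v (2 * N)" "(?L - 1\<^sub>m (2 * N)) *\<^sub>v y = z \<cdot>\<^sub>v y"
    using assms unfolding E eigenvalue_def eigenvector_def by auto
  have "(?L - 1\<^sub>m (2 * N)) *\<^sub>v y = ?L *\<^sub>v y - y"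
    using minus_mult_distrib_mat_vec[OF L _ y(1), of "1\<^sub>m (2 * N)"] y(1) by simp
  then have sub: "?L *\<^sub>v y - y = z \<cdot>\<^sub>v y" using y(3) by simp
  have Ly: "?L *\<^sub>v y \<in> carrier_vec (2 * N)" by (rule mult_mat_vec_carrier[OF L y(1)])
  have "?L *\<^sub>v y = z \<cdot>\<^sub>v y + y"
  proof (intro eq_vecI)
    fix i assume "i < dim_vec (z \<cdot>\<^sub>v y + y)"
    then have i: "i < 2 * N" using y(1) by simp
    have "vec_index (?L *\<^sub>v y - y) i = vec_index (z \<cdot>\<^sub>v y) i" by (simp only: sub)
    then show "vec_index (?L *\<^sub>v y) i = vec_index (z \<cdot>\<^sub>v y + y) i"
      using y(1) i by (simp del: index_mult_mat_vec add: algebra_simps)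
  qed (use carrier_vecD[OF Ly] carrier_vecD[OF y(1)] in simp)
  also have "\<dots> = (z + 1) \<cdot>\<^sub>v y" using y(1) by (auto intro!: eq_vecI simp: algebra_simps)
  finally have "?L *\<^sub>v y = (z + 1) \<cdot>\<^sub>v y" .
  then have "eigenvalue ?L (z + 1)"
    unfolding eigenvalue_def eigenvector_def using y(1,2) carrier_matD(1)[OF L] by auto
  then show ?thesis using left_eigenvalue_near_1 by fastforce
qed

text \<open>Triangle inequalities at an eigenvalue of maximal modulus, which exists as the order is
  positive. The upper bound yields \<open>\<theta> < 1\<close>; the lower bound leaves room in
  \<open>\<theta>\<close> for the non-normal growth of Jordan blocks.\<close>

lemma spectral_radius_left:
  assumes "0 < N"
  shows "1 - \<epsilon> \<le> spectral_radius (map_mat complex_of_real (W * S))"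
    and "spectral_radius (map_mat complex_of_real (W * S)) \<le> 1 + \<epsilon>"
proof -
  let ?L = "map_mat complex_of_real (W * S)"
  have L: "?L \<in> carrier_mat (2 * N) (2 * N)" using P_inv(1) carriers(1) by simp
  obtain z where z: "z \<in> spectrum ?L" "spectral_radius ?L = cmod z"
    using spectral_radius_mem_max(1)[OF L] assms by auto
  have "cmod (z - 1) \<le> \<epsilon>" using left_eigenvalue_near_1 z(1) by (simp add: spectrum_def)
  moreover have "cmod 1 \<le> cmod z + cmod (z - 1)" by (metis norm_minus_commute norm_triangle_sub)
  moreover have "cmod z \<le> cmod 1 + cmod (z - 1)" by (rule norm_triangle_sub)
  ultimately show "1 - \<epsilon> \<le> spectral_radius ?L" "spectral_radius ?L \<le> 1 + \<epsilon>"
    using z(2) by auto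
qed

lemma spectral_radius_error:
  assumes "0 < N"
  shows "0 \<le> spectral_radius (map_mat complex_of_real (W * S - 1\<^sub>m (2 * N)))"
    and "spectral_radius (map_mat complex_of_real (W * S - 1\<^sub>m (2 * N))) \<le> \<epsilon>"
proof -
  let ?E = "map_mat complex_of_real (W * S - 1\<^sub>m (2 * N))"
  have E: "?E \<in> carrier_mat (2 * N) (2 * N)" by (simp add: minus_carrier_mat)
  obtain z where z: "z \<in> spectrum ?E" "spectral_radius ?E = cmod z"
    using spectral_radius_mem_max(1)[OF E] assms by auto
  have "cmod z \<le> \<epsilon>" using error_eigenvalue_le z(1) by (simp add: spectrum_def)
  with z(2) show "0 \<le> spectral_radius ?E" "spectral_radius ?E \<le> \<epsilon>" by auto
qed

end

section \<open>Linear finite elements\<close>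

lemma vector_space_functions: "vector_space (\<lambda>(c::real) (v :: 'a \<Rightarrow> real) x. c * v x)"
  by unfold_locales (auto simp: fun_eq_iff plus_fun_def algebra_simps)

text \<open>The dimension is the cardinality of a basis, and infinite sets have cardinality 0. The
  finite spanning set excludes this, and \<open>f\<close> makes the basis nonempty.\<close>

lemma function_dim_pos:
  fixes V :: "('a \<Rightarrow> real) set"
  assumes f: "f \<in> V" "f \<noteq> 0" and fin: "finite S"
    and span: "\<And>v. v \<in> V \<Longrightarrow> \<exists>c. v = (\<lambda>x. \<Sum>w\<in>S. c w * w x)"
  shows "0 < vector_space.dim (\<lambda>(c::real) v x. c * v x) V"
proof -
  interpret fs: vector_space "\<lambda>(c::real) (v :: 'a \<Rightarrow> real) x. c * v x"
    by (rule vector_space_functions)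
  have "fs.independent {f}" using f(2) by (simp add: fs.dependent_single)
  then obtain B where B: "{f} \<subseteq> B" "B \<subseteq> V" "fs.independent B" "V \<subseteq> fs.span B"
    using fs.maximal_independent_subset_extend[of "{f}" V] f(1) by auto
  have "V \<subseteq> fs.span S"
  proof
    fix v assume "v \<in> V"
    then obtain c where v: "v = (\<lambda>x. \<Sum>w\<in>S. c w * w x)" using span by blast
    have "(\<Sum>w\<in>S. (\<lambda>x. c w * w x)) \<in> fs.span S"
      by (intro fs.span_sum fs.span_scale fs.span_base)
    moreover have "(\<Sum>w\<in>S. (\<lambda>x. c w * w x)) = v"
    proof
      fix x show "(\<Sum>w\<in>S. (\<lambda>x. c w * w x)) x = v x"
        unfolding v using fin by (induction S) auto
    qed
    ultimately show "v \<in> fs.span S" by simp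
  qed
  with B(2) have "finite B" using fs.independent_span_bound[OF fin B(3)] by auto
  moreover have "card B = fs.dim V" using fs.basis_card_eq_dim[OF B(2,4,3)] .
  ultimately show ?thesis using B(1) by (metis card_gt_0_iff empty_iff insert_subset)
qed

section \<open>Diffusion coefficients and integrability\<close>

lemma diffusion_coefficientE:
  fixes a :: "real ^ 'd \<Rightarrow> real ^ 'd ^ 'd"
  assumes "diffusion_coefficient \<Omega> a"
  obtains c L where "0 < c"
    and "\<And>x \<xi>. x \<in> \<Omega> \<Longrightarrow> c * (norm \<xi>)\<^sup>2 \<le> inner (a x *v \<xi>) \<xi>"
    and "\<And>x \<xi>. x \<in> \<Omega> \<Longrightarrow> inner (a x *v \<xi>) \<xi> \<le> L * (norm \<xi>)\<^sup>2"
    and "\<And>x \<xi> \<eta>. x \<in> \<Omega> \<Longrightarrow> inner (a x *v \<xi>) \<eta> = inner (a x *v \<eta>) \<xi>"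
proof -
  obtain lam Lam c L where b: "\<forall>x\<in>\<Omega>. \<forall>\<xi>.
          lam x * (norm \<xi>)\<^sup>2 \<le> inner \<xi> (a x *v \<xi>) \<and> inner \<xi> (a x *v \<xi>) \<le> Lam x * (norm \<xi>)\<^sup>2"
    and c: "c > 0" "\<forall>x\<in>\<Omega>. c \<le> lam x" and L: "\<forall>x\<in>\<Omega>. Lam x \<le> L"
    and sym: "\<forall>x\<in>\<Omega>. Finite_Cartesian_Product.transpose (a x) = a x"
    using assms unfolding diffusion_coefficient_def by blast
  show ?thesis
  proof (rule that[OF c(1)])
    fix x :: "real ^ 'd" and \<xi> :: "real ^ 'd" assume x: "x \<in> \<Omega>"
    have "c * (norm \<xi>)\<^sup>2 \<le> lam x * (norm \<xi>)\<^sup>2" using c x by (intro mult_right_mono) auto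
    then show "c * (norm \<xi>)\<^sup>2 \<le> inner (a x *v \<xi>) \<xi>" using b x by (metis inner_commute order_trans)
    have "Lam x * (norm \<xi>)\<^sup>2 \<le> L * (norm \<xi>)\<^sup>2" using L x by (intro mult_right_mono) auto
    then show "inner (a x *v \<xi>) \<xi> \<le> L * (norm \<xi>)\<^sup>2" using b x by (metis inner_commute order_trans)
    fix \<eta>
    have "inner (a x *v \<xi>) \<eta> = inner (Finite_Cartesian_Product.transpose (a x) *v \<xi>) \<eta>" using sym x by simp
    also have "\<dots> = inner \<xi> (a x *v \<eta>)" unfolding transpose_matrix_vector dot_lmul_matrix ..
    finally show "inner (a x *v \<xi>) \<eta> = inner (a x *v \<eta>) \<xi>" by (simp add: inner_commute)
  qed
qed

text \<open>The hypotheses bound only the quadratic form. Polarization expresses the mixed form as a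
  difference of two nonnegative values and so bounds it by the constant \<open>K\<close> on a set of
  finite measure.\<close>

lemma diffusion_form_integrable:
  fixes a :: "real ^ 'd \<Rightarrow> real ^ 'd ^ 'd"
  assumes a: "diffusion_coefficient \<Omega> a" and \<Omega>: "open \<Omega>" "bounded \<Omega>"
  shows "set_integrable lebesgue \<Omega> (\<lambda>x. inner (a x *v \<xi>) \<eta>)"
proof -
  obtain c L where c: "0 < c" "\<And>x \<xi>. x \<in> \<Omega> \<Longrightarrow> c * (norm \<xi>)\<^sup>2 \<le> inner (a x *v \<xi>) \<xi>"
    and L: "\<And>x \<xi>. x \<in> \<Omega> \<Longrightarrow> inner (a x *v \<xi>) \<xi> \<le> L * (norm \<xi>)\<^sup>2"
    and sym: "\<And>x \<xi> \<eta>. x \<in> \<Omega> \<Longrightarrow> inner (a x *v \<xi>) \<eta> = inner (a x *v \<eta>) \<xi>"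
    using diffusion_coefficientE[OF a] by metis
  define K where "K = (L * (norm (\<xi> + \<eta>))\<^sup>2 + L * (norm (\<xi> - \<eta>))\<^sup>2) / 4"
  have "(\<lambda>m. inner (m *v \<xi>) \<eta>) \<in> borel_measurable borel"
    by (intro borel_measurable_continuous_onI)
       (auto simp: inner_vec_def matrix_vector_mult_def intro!: continuous_intros)
  moreover have "a \<in> borel_measurable (lebesgue_on \<Omega>)" using a by (simp add: diffusion_coefficient_def)
  ultimately have meas: "(\<lambda>x. inner (a x *v \<xi>) \<eta>) \<in> borel_measurable (lebesgue_on \<Omega>)"
    by (rule measurable_compose[rotated])
  show ?thesis
  proof (rule measurable_bounded_by_integrable_imp_absolutely_integrable[OF meas])
    show "\<Omega> \<in> sets lebesgue" using \<Omega>(1) by (simp add: lmeasurable_open fmeasurableD \<Omega>(2))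
    show "(\<lambda>x. K) integrable_on \<Omega>"
      using \<Omega> by (intro integrable_on_const) (simp add: lmeasurable_open)
    fix x assume x: "x \<in> \<Omega>"
    have nn: "0 \<le> inner (a x *v \<zeta>) \<zeta>" for \<zeta>
      by (rule order_trans[OF _ c(2)[OF x]]) (use c(1) in simp)
    have "4 * inner (a x *v \<xi>) \<eta> = inner (a x *v (\<xi> + \<eta>)) (\<xi> + \<eta>) - inner (a x *v (\<xi> - \<eta>)) (\<xi> - \<eta>)"
      using sym[OF x, of \<xi> \<eta>]
      by (simp add: matrix_vector_right_distrib matrix_vector_mult_diff_distrib inner_simps)
    then show "norm (inner (a x *v \<xi>) \<eta>) \<le> K"
      using nn[of "\<xi> + \<eta>"] nn[of "\<xi> - \<eta>"] L[OF x, of "\<xi> + \<eta>"] L[OF x, of "\<xi> - \<eta>"]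
      unfolding K_def by (simp add: abs_le_iff)
  qed
qed

lemma weighted_sum_set_integral:
  fixes F :: "nat \<Rightarrow> nat \<Rightarrow> 'a \<Rightarrow> real"
  assumes "\<And>i j. i < N \<Longrightarrow> j < N \<Longrightarrow> set_integrable M S (F i j)"
  shows "set_integrable M S (\<lambda>x. \<Sum>i<N. \<Sum>j<N. w i j * F i j x)"
    and "(\<Sum>i<N. \<Sum>j<N. w i j * (LINT x:S|M. F i j x)) = (LINT x:S|M. \<Sum>i<N. \<Sum>j<N. w i j * F i j x)"
proof -
  have i: "integrable M (\<lambda>x. indicator S x * (w i j * F i j x))" if "i < N" "j < N" for i j
    using set_integrable_mult_right[OF assms[OF that], of "w i j"] by (simp add: set_integrable_def)
  show "set_integrable M S (\<lambda>x. \<Sum>i<N. \<Sum>j<N. w i j * F i j x)"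
    unfolding set_integrable_def real_scaleR_def sum_distrib_left
    by (intro Bochner_Integration.integrable_sum i) auto
  have "(LINT x:S|M. \<Sum>i<N. \<Sum>j<N. w i j * F i j x) =
      (LINT x|M. (\<Sum>i<N. \<Sum>j<N. indicator S x * (w i j * F i j x)))"
    unfolding set_lebesgue_integral_def real_scaleR_def sum_distrib_left ..
  also have "\<dots> = (\<Sum>i<N. (LINT x|M. (\<Sum>j<N. indicator S x * (w i j * F i j x))))"
    by (intro Bochner_Integration.integral_sum Bochner_Integration.integrable_sum i) auto
  also have "\<dots> = (\<Sum>i<N. \<Sum>j<N. (LINT x|M. indicator S x * (w i j * F i j x)))"
    by (intro sum.cong refl Bochner_Integration.integral_sum i) auto
  also have "\<dots> = (\<Sum>i<N. \<Sum>j<N. w i j * (LINT x:S|M. F i j x))"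
    by (simp add: set_lebesgue_integral_def mult.left_commute[of "indicator _ _"])
  finally show "(\<Sum>i<N. \<Sum>j<N. w i j * (LINT x:S|M. F i j x)) = (LINT x:S|M. \<Sum>i<N. \<Sum>j<N. w i j * F i j x)" ..
qed

section \<open>Cells, nodal basis and gradients\<close>

locale fe_mesh =
  fixes \<Omega> :: "(real ^ 'd) set" and T :: "(real ^ 'd) set set" and N :: nat
    and \<phi> :: "nat \<Rightarrow> real ^ 'd \<Rightarrow> real" and z :: "nat \<Rightarrow> real ^ 'd"
  assumes dom: "open \<Omega>" "connected \<Omega>" "\<Omega> \<noteq> {}" "bounded \<Omega>"
    and tri: "triangulates T \<Omega>"
    and nodes: "bij_betw z {..<N} (interior_nodes \<Omega> T)"
    and basis_space: "\<And>i. i < N \<Longrightarrow> \<phi> i \<in> fe_space \<Omega> T"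
    and basis_nodes: "\<And>i j. i < N \<Longrightarrow> j < N \<Longrightarrow> \<phi> i (z j) = (if i = j then 1 else 0)"
begin

lemma finite_cells: "finite T" and cells_cover: "\<Union>T = closure \<Omega>"
  using tri by (auto simp: triangulates_def triangulation_def)

lemma cellE:
  assumes "K \<in> T"
  obtains C where "finite C" "\<not> affine_dependent C" "card C = Suc DIM(real ^ 'd)" "K = convex hull C"
proof -
  have "int CARD('d) simplex K" using tri assms by (simp add: triangulates_def)
  then obtain C where "finite C" "\<not> affine_dependent C" "int (card C) = int CARD('d) + 1" "K = convex hull C"
    unfolding simplex by blast
  then show ?thesis by (intro that[of C]) auto
qed

lemma interior_cell_nonempty: "K \<in> T \<Longrightarrow> interior K \<noteq> {}"
  by (metis cellE interior_convex_hull_eq_empty)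

lemma convex_cell: "K \<in> T \<Longrightarrow> convex K"
  by (metis cellE convex_convex_hull)

lemma compact_cell: "K \<in> T \<Longrightarrow> compact K"
  by (metis cellE finite_imp_compact_convex_hull)

text \<open>A point of the domain in no cell interior lies on the frontier of a cell, and frontiers
  of convex sets are null sets.\<close>

lemma negligible_skeleton: "negligible (\<Omega> - (\<Union>K\<in>T. interior K))"
proof (rule negligible_subset)
  show "negligible (\<Union>K\<in>T. frontier K)"
    using finite_cells convex_cell by (intro negligible_Union) (auto intro: negligible_convex_frontier)
  show "\<Omega> - (\<Union>K\<in>T. interior K) \<subseteq> (\<Union>K\<in>T. frontier K)"
  proof
    fix x assume x: "x \<in> \<Omega> - (\<Union>K\<in>T. interior K)"
    then have "x \<in> \<Union>T" using cells_cover closure_subset by auto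
    then obtain K where "K \<in> T" "x \<in> K" by auto
    then show "x \<in> (\<Union>K\<in>T. frontier K)"
      using x closure_subset[of K] by (auto simp: frontier_def)
  qed
qed

lemma AE_interior_cell: "AE x\<in>\<Omega> in lebesgue. \<exists>K\<in>T. x \<in> interior K"
  using negligible_skeleton unfolding negligible_iff_null_sets
  by (rule AE_I') auto

text \<open>The interior is a nonempty open subset of the closure of the domain.\<close>

lemma interior_cell_meets: "K \<in> T \<Longrightarrow> interior K \<inter> \<Omega> \<noteq> {}"
  using interior_cell_nonempty[of K] cells_cover interior_subset[of K]
    open_Int_closure_eq_empty[OF open_interior, of K \<Omega>] by blast

text \<open>Vertices inside the domain are nodes; at all others the extension by zero gives the
  value.\<close>

lemma basis_at_vertex:
  assumes "K \<in> T" "c extreme_point_of K" "i < N"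
  shows "\<phi> i c = (if c = z i then 1 else 0)"
proof (cases "c \<in> \<Omega>")
  case True
  then have "c \<in> interior_nodes \<Omega> T" using assms by (auto simp: interior_nodes_def)
  then obtain j where j: "j < N" "c = z j" using nodes by (auto simp: bij_betw_def)
  moreover have "z j = z i \<longleftrightarrow> i = j" using nodes j(1) assms(3) by (auto simp: bij_betw_def inj_on_def)
  ultimately show ?thesis using basis_nodes[OF assms(3) j(1)] by auto
next
  case False
  have "z i \<in> interior_nodes \<Omega> T" using nodes assms(3) by (auto simp: bij_betw_def)
  then have "z i \<in> \<Omega>" by (simp add: interior_nodes_def)
  then show ?thesis using False basis_space[OF assms(3)] by (auto simp: fe_space_def)
qed

text \<open>On a cell the function is affine; weights with sum 1 reproduce its constant
  term.\<close>

lemma fe_affine_combination: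
  assumes "v \<in> fe_space \<Omega> T" "K \<in> T" "K = convex hull C" "finite C"
    and "sum \<beta> C = 1" "\<And>c. c \<in> C \<Longrightarrow> 0 \<le> \<beta> c"
  shows "v (\<Sum>c\<in>C. \<beta> c *\<^sub>R c) = (\<Sum>c\<in>C. \<beta> c * v c)"
proof -
  obtain g e where g: "\<And>x. x \<in> K \<Longrightarrow> v x = inner g x + e"
    using assms(1,2) unfolding fe_space_def by blast
  have "(\<Sum>c\<in>C. \<beta> c *\<^sub>R c) \<in> K" using assms by (auto simp: convex_hull_finite)
  then have "v (\<Sum>c\<in>C. \<beta> c *\<^sub>R c) = (\<Sum>c\<in>C. \<beta> c * inner g c) + (\<Sum>c\<in>C. \<beta> c * e)"
    using assms(5) by (simp add: g inner_sum_right flip: sum_distrib_right)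
  also have "\<dots> = (\<Sum>c\<in>C. \<beta> c * v c)"
    unfolding sum.distrib[symmetric]
  proof (intro sum.cong refl)
    fix c assume "c \<in> C"
    then have "v c = inner g c + e" using assms(3) by (intro g) (simp add: hull_inc)
    then show "\<beta> c * inner g c + \<beta> c * e = \<beta> c * v c" by (simp add: distrib_left)
  qed
  finally show ?thesis .
qed

text \<open>On a cell \<open>\<phi> i\<close> is the barycentric coordinate of \<open>z i\<close> if
  that is a vertex, and 0 otherwise. The sum may be less than 1, as vertices on the frontier have no
  basis function.\<close>

lemma basis_on_cell:
  assumes K: "K \<in> T" and x: "x \<in> K"
  shows "i < N \<Longrightarrow> 0 \<le> \<phi> i x" and "(\<Sum>i<N. \<phi> i x) \<le> 1" and "i < N \<Longrightarrow> \<phi> i x \<noteq> 0 \<Longrightarrow> z i \<in> K"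
    and "v \<in> fe_space \<Omega> T \<Longrightarrow> v x = (\<Sum>i<N. v (z i) * \<phi> i x)"
proof -
  obtain C where C: "finite C" "\<not> affine_dependent C" "K = convex hull C" using cellE[OF K] by metis
  obtain \<beta> where \<beta>: "\<And>c. c \<in> C \<Longrightarrow> 0 \<le> \<beta> c" "sum \<beta> C = 1" "x = (\<Sum>c\<in>C. \<beta> c *\<^sub>R c)"
    using x unfolding C(3) convex_hull_finite[OF C(1)] by auto
  have ext: "c extreme_point_of K" if "c \<in> C" for c
    using that C extreme_point_of_convex_hull_affine_independent by blast
  have phi: "\<phi> i x = (\<Sum>c\<in>C. if c = z i then \<beta> c else 0)" if i: "i < N" for i
  proof -
    have "\<phi> i x = (\<Sum>c\<in>C. \<beta> c * \<phi> i c)"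
      unfolding \<beta>(3) by (rule fe_affine_combination[OF basis_space[OF i] K C(3,1) \<beta>(2,1)])
    also have "\<dots> = (\<Sum>c\<in>C. if c = z i then \<beta> c else 0)"
      by (intro sum.cong refl) (simp add: basis_at_vertex[OF K ext i])
    finally show ?thesis .
  qed
  then have phi': "\<phi> i x = (if z i \<in> C then \<beta> (z i) else 0)" if i: "i < N" for i
    using C(1) i by simp
  show "i < N \<Longrightarrow> 0 \<le> \<phi> i x" using phi' \<beta>(1) by auto
  show "i < N \<Longrightarrow> \<phi> i x \<noteq> 0 \<Longrightarrow> z i \<in> K" using phi' C(3) hull_inc[of "z i" C] by (auto split: if_splits)
  have inj: "inj_on z {..<N}" using nodes by (simp add: bij_betw_def)
  have "(\<Sum>i<N. \<phi> i x) = (\<Sum>c\<in>C. \<Sum>i<N. if c = z i then \<beta> c else 0)"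
    by (simp add: phi sum.swap[of _ C])
  also have "\<dots> \<le> (\<Sum>c\<in>C. \<beta> c)"
  proof (rule sum_mono)
    fix c assume c: "c \<in> C"
    \<comment> \<open>Injectivity of \<open>z\<close> leaves at most one index for each
      vertex.\<close>
    have "(\<Sum>i<N. if c = z i then \<beta> c else 0) = (\<Sum>i\<in>{i. i < N \<and> c = z i}. \<beta> c)"
      by (simp add: sum.If_cases lessThan_def Collect_conj_eq)
    also have "\<dots> = real (card {i. i < N \<and> c = z i}) * \<beta> c" by (rule sum_constant)
    also have "\<dots> \<le> 1 * \<beta> c"
    proof (rule mult_right_mono[OF _ \<beta>(1)[OF c]])
      have "card {i. i < N \<and> c = z i} \<le> Suc 0"
        using inj by (subst card_le_Suc0_iff_eq) (auto simp: inj_on_def)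
      then show "real (card {i. i < N \<and> c = z i}) \<le> 1" by simp
    qed
    finally show "(\<Sum>i<N. if c = z i then \<beta> c else 0) \<le> \<beta> c" by simp
  qed
  finally show "(\<Sum>i<N. \<phi> i x) \<le> 1" using \<beta>(2) by simp
  assume v: "v \<in> fe_space \<Omega> T"
  \<comment> \<open>A vertex in the domain is hit by exactly one index; at any other vertex
    \<open>v\<close> vanishes and both sides are 0.\<close>
  have vertex: "(\<Sum>i<N. if c = z i then v (z i) * \<beta> c else 0) = \<beta> c * v c" if c: "c \<in> C" for c
  proof (cases "c \<in> \<Omega>")
    case True
    then have "c \<in> interior_nodes \<Omega> T" using K ext[OF c] by (auto simp: interior_nodes_def)
    then obtain j where j: "j < N" "c = z j" using nodes by (auto simp: bij_betw_def)
    have "(\<Sum>i<N. if c = z i then v (z i) * \<beta> c else 0) = (\<Sum>i<N. if i = j then v (z i) * \<beta> c else 0)"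
      using inj j by (intro sum.cong) (auto simp: inj_on_def)
    then show ?thesis using j by simp
  next
    case False
    then have "v c = 0" using v by (simp add: fe_space_def)
    moreover have "(\<Sum>i<N. if c = z i then v (z i) * \<beta> c else 0) = 0"
      using \<open>v c = 0\<close> by (intro sum.neutral) auto
    ultimately show ?thesis by simp
  qed
  have "v x = (\<Sum>c\<in>C. \<beta> c * v c)"
    unfolding \<beta>(3) by (rule fe_affine_combination[OF v K C(3,1) \<beta>(2,1)])
  also have "\<dots> = (\<Sum>c\<in>C. \<Sum>i<N. if c = z i then v (z i) * \<beta> c else 0)" by (simp add: vertex)
  also have "\<dots> = (\<Sum>i<N. \<Sum>c\<in>C. if c = z i then v (z i) * \<beta> c else 0)" by (rule sum.swap)
  also have "\<dots> = (\<Sum>i<N. v (z i) * \<phi> i x)"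
    by (intro sum.cong refl) (simp add: phi sum_distrib_left if_distrib cong: if_cong)
  finally show "v x = (\<Sum>i<N. v (z i) * \<phi> i x)" .
qed

text \<open>The nodal basis spans and is nonempty. Thus the dimension in the constant
  \<open>C\<^sub>0\<close> is a factor of at least 1.\<close>

lemma fe_dim_pos:
  assumes "0 < N"
  shows "0 < fe_dim \<Omega> T"
  unfolding fe_dim_def
proof (rule function_dim_pos)
  show "\<phi> 0 \<in> fe_space \<Omega> T" using basis_space assms by simp
  show "\<phi> 0 \<noteq> 0" using basis_nodes[of 0 0] assms by auto
  show "finite (\<phi> ` {..<N})" by simp
  have inj: "inj_on \<phi> {..<N}"
    using basis_nodes by (intro inj_onI) (metis lessThan_iff zero_neq_one)
  fix v assume v: "v \<in> fe_space \<Omega> T"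
  have vx: "v x = (\<Sum>i<N. v (z i) * \<phi> i x)" for x
  proof (cases "x \<in> \<Omega>")
    case True
    then have "x \<in> \<Union>T" using cells_cover closure_subset by auto
    then show ?thesis using basis_on_cell(4)[OF _ _ v] by blast
  next
    case False
    then show ?thesis using v basis_space by (simp add: fe_space_def)
  qed
  have "(\<Sum>w\<in>\<phi> ` {..<N}. v (z (inv_into {..<N} \<phi> w)) * w x) = (\<Sum>i<N. v (z i) * \<phi> i x)" for x
    unfolding sum.reindex[OF inj] by (intro sum.cong refl) (simp add: inv_into_f_f[OF inj])
  then have "v = (\<lambda>x. \<Sum>w\<in>\<phi> ` {..<N}. v (z (inv_into {..<N} \<phi> w)) * w x)"
    by (intro ext) (rule vx[THEN trans], rule sym)
  then show "\<exists>c. v = (\<lambda>x. \<Sum>w\<in>\<phi> ` {..<N}. c w * w x)"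
    by (rule exI[of _ "\<lambda>w. v (z (inv_into {..<N} \<phi> w))"])
qed

text \<open>Near an interior point of a cell the function coincides with its affine piece.\<close>

lemma grad_on_cell:
  assumes v: "v \<in> fe_space \<Omega> T" and K: "K \<in> T"
  obtains g e where "\<And>x. x \<in> K \<Longrightarrow> v x = inner g x + e" "\<And>x. x \<in> interior K \<Longrightarrow> grad v x = g"
proof -
  obtain g e where g: "\<And>x. x \<in> K \<Longrightarrow> v x = inner g x + e"
    using v K unfolding fe_space_def by blast
  show ?thesis
  proof (rule that[OF g])
    fix x assume x: "x \<in> interior K"
    have "((\<lambda>x. inner g x + e) has_derivative (\<lambda>h. inner g h)) (at x)"
      by (auto intro!: derivative_eq_intros)
    then have "(v has_derivative (\<lambda>h. inner g h)) (at x)"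
      by (rule has_derivative_transform_within_open[OF _ open_interior x])
         (use g interior_subset in force)
    then have "frechet_derivative v (at x) = (\<lambda>h. inner g h)" by (rule frechet_derivative_at[symmetric])
    then show "grad v x = g" by (simp add: grad_def inner_axis vec_eq_iff)
  qed
qed

text \<open>The gradient of the function with nodal values \<open>p\<close>, as a combination of
  basis gradients. It is linear in \<open>p\<close> everywhere, including the skeleton, where
  derivatives may fail to exist.\<close>

definition fe_grad :: "(nat \<Rightarrow> real) \<Rightarrow> real ^ 'd \<Rightarrow> real ^ 'd" where
  "fe_grad p x = (\<Sum>i<N. p i *\<^sub>R grad (\<phi> i) x)"

lemma fe_grad_on_cell:
  assumes K: "K \<in> T"
  obtains G e where "\<And>x. x \<in> K \<Longrightarrow> (\<Sum>i<N. p i * \<phi> i x) = inner G x + e"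
    "\<And>x. x \<in> interior K \<Longrightarrow> fe_grad p x = G"
proof -
  have "\<exists>g e. (\<forall>x\<in>K. \<phi> i x = inner g x + e) \<and> (\<forall>x\<in>interior K. grad (\<phi> i) x = g)" if "i < N" for i
    using grad_on_cell[OF basis_space[OF that] K] by metis
  then obtain g e where g: "\<And>i x. i < N \<Longrightarrow> x \<in> K \<Longrightarrow> \<phi> i x = inner (g i) x + e i"
    "\<And>i x. i < N \<Longrightarrow> x \<in> interior K \<Longrightarrow> grad (\<phi> i) x = g i" by metis
  show ?thesis
  proof (rule that[of "\<Sum>i<N. p i *\<^sub>R g i" "\<Sum>i<N. p i * e i"])
    show "(\<Sum>i<N. p i * \<phi> i x) = inner (\<Sum>i<N. p i *\<^sub>R g i) x + (\<Sum>i<N. p i * e i)" if "x \<in> K" for x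
      using that by (simp add: g inner_sum_left distrib_left sum.distrib)
    show "fe_grad p x = (\<Sum>i<N. p i *\<^sub>R g i)" if "x \<in> interior K" for x
      using that by (simp add: fe_grad_def g)
  qed
qed

lemma nodal_value:
  assumes "i < N" shows "(\<Sum>j<N. p j * \<phi> j (z i)) = p i"
proof -
  have "(\<Sum>j<N. p j * \<phi> j (z i)) = (\<Sum>j<N. if j = i then p j else 0)"
    using assms by (intro sum.cong) (auto simp: basis_nodes)
  then show ?thesis using assms by simp
qed

lemma diameter_le_mesh_size: "K \<in> T \<Longrightarrow> diameter K \<le> mesh_size T"
  unfolding mesh_size_def using finite_cells by (intro Max_ge) auto

text \<open>Only pairs with both nodes in the cell of \<open>x\<close> contribute. There the nodal
  values differ by the gradient applied to \<open>z i - z j\<close>, whose length is at most the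
  mesh size, and the weights have total at most 1.\<close>

lemma local_defect_le:
  assumes K: "K \<in> T" and x: "x \<in> interior K"
  shows "(\<Sum>i<N. \<Sum>j<N. \<phi> i x * \<phi> j x * (p i - p j)\<^sup>2) \<le> (mesh_size T)\<^sup>2 * (norm (fe_grad p x))\<^sup>2"
proof -
  let ?G = "fe_grad p x" and ?h = "mesh_size T"
  have xK: "x \<in> K" using x interior_subset by blast
  obtain e where G: "\<And>y. y \<in> K \<Longrightarrow> (\<Sum>i<N. p i * \<phi> i y) = inner ?G y + e"
    using fe_grad_on_cell[OF K, of p] x by metis
  have nn: "0 \<le> \<phi> i x" if "i < N" for i using basis_on_cell(1)[OF K xK that] .
  have "\<phi> i x * \<phi> j x * (p i - p j)\<^sup>2 \<le> \<phi> i x * \<phi> j x * (?h\<^sup>2 * (norm ?G)\<^sup>2)" if i: "i < N" and j: "j < N" for i j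
  proof (cases "\<phi> i x = 0 \<or> \<phi> j x = 0")
    case False
    then have zK: "z i \<in> K" "z j \<in> K" using basis_on_cell(3)[OF K xK] i j by auto
    have "p i - p j = inner ?G (z i - z j)"
      using G[OF zK(1)] G[OF zK(2)] nodal_value[OF i, of p] nodal_value[OF j, of p] by (simp add: inner_diff_right)
    then have "\<bar>p i - p j\<bar> \<le> norm ?G * norm (z i - z j)" by (simp add: Cauchy_Schwarz_ineq2)
    also have "\<dots> \<le> norm ?G * ?h"
      using diameter_bounded_bound[OF compact_imp_bounded[OF compact_cell[OF K]] zK] diameter_le_mesh_size[OF K]
      by (intro mult_left_mono) (auto simp: dist_norm)
    finally have "(p i - p j)\<^sup>2 \<le> (norm ?G * ?h)\<^sup>2"
      by (metis abs_ge_zero power2_abs power_mono)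
    then show ?thesis using nn i j by (intro mult_left_mono) (auto simp: power_mult_distrib mult.commute)
  qed auto
  then have "(\<Sum>i<N. \<Sum>j<N. \<phi> i x * \<phi> j x * (p i - p j)\<^sup>2) \<le> (\<Sum>i<N. \<Sum>j<N. \<phi> i x * \<phi> j x * (?h\<^sup>2 * (norm ?G)\<^sup>2))"
    by (intro sum_mono) auto
  \<comment> \<open>The double sum of the weights factorizes.\<close>
  also have "\<dots> = (\<Sum>i<N. \<phi> i x) * (\<Sum>i<N. \<phi> i x) * (?h\<^sup>2 * (norm ?G)\<^sup>2)"
    unfolding sum_product unfolding sum_distrib_right ..
  also have "\<dots> \<le> 1 * (?h\<^sup>2 * (norm ?G)\<^sup>2)"
    using basis_on_cell(2)[OF K xK] nn by (intro mult_right_mono mult_le_one) (auto intro!: sum_nonneg)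
  finally show ?thesis by simp
qed

end

section \<open>The lumping defect and the stiffness energy\<close>

text \<open>Expand the square: by symmetry both pure squares give the row sums on the diagonal, half
  each, and the mixed term gives \<open>M\<close>.\<close>

lemma lumped_defect_quad:
  fixes M :: "real Matrix.mat"
  assumes M: "M \<in> carrier_mat N N" and sym: "symm_on N (\<lambda>i j. M $$ (i, j))"
  shows "quad N (\<lambda>i j. lumped M $$ (i, j) - M $$ (i, j)) p =
    (\<Sum>i<N. \<Sum>j<N. (p i - p j)\<^sup>2 / 2 * M $$ (i, j))"
proof -
  have "quad N (\<lambda>i j. lumped M $$ (i, j) - M $$ (i, j)) p =
      (\<Sum>i<N. \<Sum>j<N. (if i = j then p i * (\<Sum>k<N. M $$ (i, k)) * p i else 0) - p i * M $$ (i, j) * p j)"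
    unfolding quad_def
  proof (intro sum.cong refl)
    fix i j assume "i \<in> {..<N}" "j \<in> {..<N}"
    then have "lumped M $$ (i, j) = (if i = j then \<Sum>k<N. M $$ (i, k) else 0)"
      using M by (auto simp: lumped_def mat_diag_def)
    then show "p i * (lumped M $$ (i, j) - M $$ (i, j)) * p j =
        (if i = j then p i * (\<Sum>k<N. M $$ (i, k)) * p i else 0) - p i * M $$ (i, j) * p j"
      by (simp add: algebra_simps)
  qed
  also have "\<dots> = (\<Sum>i<N. \<Sum>k<N. (p i)\<^sup>2 * M $$ (i, k)) - (\<Sum>i<N. \<Sum>j<N. p i * M $$ (i, j) * p j)"
  proof -
    have "p i * (\<Sum>k<N. M $$ (i, k)) * p i = (\<Sum>k<N. (p i)\<^sup>2 * M $$ (i, k))" for i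
      unfolding sum_distrib_left[symmetric] power2_eq_square by (simp only: mult_ac)
    moreover have "(\<Sum>i<N. \<Sum>j<N. if i = j then g i else 0) = (\<Sum>i<N. g i)" for g :: "nat \<Rightarrow> real"
      by (intro sum.cong refl) simp
    ultimately show ?thesis unfolding sum_subtractf by simp
  qed
  finally have 1: "quad N (\<lambda>i j. lumped M $$ (i, j) - M $$ (i, j)) p = \<dots>" .
  \<comment> \<open>Exchanging the indices and using symmetry identifies the two pure
    squares.\<close>
  have "(\<Sum>i<N. \<Sum>j<N. (p j)\<^sup>2 * M $$ (i, j)) = (\<Sum>j<N. \<Sum>i<N. (p j)\<^sup>2 * M $$ (i, j))"
    by (rule sum.swap)
  also have "\<dots> = (\<Sum>i<N. \<Sum>j<N. (p i)\<^sup>2 * M $$ (i, j))"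
  proof (intro sum.cong refl)
    fix i j assume "i \<in> {..<N}" "j \<in> {..<N}"
    then have "M $$ (j, i) = M $$ (i, j)" using sym unfolding symm_on_def by blast
    then show "(p i)\<^sup>2 * M $$ (j, i) = (p i)\<^sup>2 * M $$ (i, j)" by simp
  qed
  finally have 2: "(\<Sum>i<N. \<Sum>j<N. (p j)\<^sup>2 * M $$ (i, j)) = (\<Sum>i<N. \<Sum>j<N. (p i)\<^sup>2 * M $$ (i, j))" .
  have "(\<Sum>i<N. \<Sum>j<N. (p i - p j)\<^sup>2 / 2 * M $$ (i, j)) =
     (\<Sum>i<N. \<Sum>j<N. (1/2) * ((p i)\<^sup>2 * M $$ (i, j)) + (1/2) * ((p j)\<^sup>2 * M $$ (i, j)) - p i * M $$ (i, j) * p j)"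
    by (intro sum.cong refl) (simp add: power2_eq_square field_simps)
  also have "\<dots> = (\<Sum>i<N. \<Sum>k<N. (p i)\<^sup>2 * M $$ (i, k)) - (\<Sum>i<N. \<Sum>j<N. p i * M $$ (i, j) * p j)"
    unfolding sum_subtractf sum.distrib sum_distrib_left[symmetric] 2 by simp
  finally show ?thesis using 1 by simp
qed

context fe_mesh
begin

lemma sets_domain: "\<Omega> \<in> sets lebesgue"
  using dom by (simp add: lmeasurable_open fmeasurableD)

lemma mass_integrable:
  assumes "i < N" "j < N"
  shows "set_integrable lebesgue \<Omega> (\<lambda>x. \<phi> i x * \<phi> j x)"
proof -
  have "continuous_on (closure \<Omega>) (\<lambda>x. \<phi> i x * \<phi> j x)"
    using basis_space assms by (intro continuous_on_mult) (auto simp: fe_space_def)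
  moreover have "compact (closure \<Omega>)" using dom by simp
  ultimately have "integrable lborel (\<lambda>x. indicator (closure \<Omega>) x *\<^sub>R (\<phi> i x * \<phi> j x))"
    by (intro borel_integrable_compact)
  then have "integrable lebesgue (\<lambda>x. indicator (closure \<Omega>) x *\<^sub>R (\<phi> i x * \<phi> j x))"
    using integrable_completion borel_measurable_integrable by blast
  then have "set_integrable lebesgue (closure \<Omega>) (\<lambda>x. \<phi> i x * \<phi> j x)" by (simp add: set_integrable_def)
  then show ?thesis by (rule set_integrable_subset) (auto simp: sets_domain closure_subset)
qed

text \<open>In each cell interior the gradients are constant; the skeleton is a null set.\<close>

lemma stiffness_integrable:
  assumes a: "diffusion_coefficient \<Omega> a" and ij: "i < N" "j < N"
  shows "set_integrable lebesgue \<Omega> (\<lambda>x. inner (a x *v grad (\<phi> i) x) (grad (\<phi> j) x))"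
    (is "set_integrable lebesgue \<Omega> ?f")
proof -
  have "set_integrable lebesgue (\<Union>K\<in>T. \<Omega> \<inter> interior K) ?f"
  proof (rule set_integrable_UN[OF finite_cells])
    fix K assume K: "K \<in> T"
    show sets: "\<Omega> \<inter> interior K \<in> sets lebesgue" using sets_domain by (intro sets.Int) auto
    obtain gi gj where "\<And>x. x \<in> interior K \<Longrightarrow> grad (\<phi> i) x = gi" "\<And>x. x \<in> interior K \<Longrightarrow> grad (\<phi> j) x = gj"
      using grad_on_cell[OF basis_space[OF ij(1)] K] grad_on_cell[OF basis_space[OF ij(2)] K] by metis
    moreover have "set_integrable lebesgue (\<Omega> \<inter> interior K) (\<lambda>x. inner (a x *v gi) gj)"
      by (rule set_integrable_subset[OF diffusion_form_integrable[OF a dom(1,4)] sets]) simp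
    ultimately show "set_integrable lebesgue (\<Omega> \<inter> interior K) ?f"
      by (subst set_integrable_cong[OF refl refl, of _ _ "\<lambda>x. inner (a x *v gi) gj"]) auto
  qed
  then show ?thesis
    by (subst absolutely_integrable_spike_set_eq[of _ "\<Union>K\<in>T. \<Omega> \<inter> interior K"])
       (auto intro: negligible_subset[OF negligible_skeleton])
qed

lemma stiffness_quad:
  assumes a: "diffusion_coefficient \<Omega> a"
  shows "set_integrable lebesgue \<Omega> (\<lambda>x. inner (a x *v fe_grad p x) (fe_grad p x))"
    and "quad N (\<lambda>i j. stiffness_matrix \<Omega> a N \<phi> $$ (i, j)) p =
      (LINT x:\<Omega>|lebesgue. inner (a x *v fe_grad p x) (fe_grad p x))"
proof -
  have lin: "(\<Sum>i<N. \<Sum>j<N. (p i * p j) * inner (a x *v grad (\<phi> i) x) (grad (\<phi> j) x)) =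
      inner (a x *v fe_grad p x) (fe_grad p x)" for x
    unfolding fe_grad_def linear_sum[OF matrix_vector_mul_linear] inner_sum_left
    unfolding inner_sum_right by (simp add: matrix_vector_mult_scaleR mult_ac)
  note w = weighted_sum_set_integral[where N = N and w = "\<lambda>i j. p i * p j"
      and F = "\<lambda>i j x. inner (a x *v grad (\<phi> i) x) (grad (\<phi> j) x)", OF stiffness_integrable[OF a]]
  show "set_integrable lebesgue \<Omega> (\<lambda>x. inner (a x *v fe_grad p x) (fe_grad p x))"
    using w(1) unfolding lin by simp
  have "quad N (\<lambda>i j. stiffness_matrix \<Omega> a N \<phi> $$ (i, j)) p =
      (\<Sum>i<N. \<Sum>j<N. (p i * p j) * (LINT x:\<Omega>|lebesgue. inner (a x *v grad (\<phi> i) x) (grad (\<phi> j) x)))"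
    unfolding quad_def by (intro sum.cong refl) (simp add: stiffness_matrix_def)
  then show "quad N (\<lambda>i j. stiffness_matrix \<Omega> a N \<phi> $$ (i, j)) p =
      (LINT x:\<Omega>|lebesgue. inner (a x *v fe_grad p x) (fe_grad p x))"
    using w(2) unfolding lin by simp
qed

lemma symm_stiffness:
  assumes a: "diffusion_coefficient \<Omega> a"
  shows "symm_on N (\<lambda>i j. stiffness_matrix \<Omega> a N \<phi> $$ (i, j))"
  unfolding symm_on_def
proof (intro allI impI)
  fix i j assume ij: "i < N" "j < N"
  have "inner (a x *v \<xi>) \<eta> = inner (a x *v \<eta>) \<xi>" if "x \<in> \<Omega>" for x \<xi> \<eta>
    using diffusion_coefficientE[OF a] that by metis
  then have "(LINT x:\<Omega>|lebesgue. inner (a x *v grad (\<phi> i) x) (grad (\<phi> j) x)) =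
      (LINT x:\<Omega>|lebesgue. inner (a x *v grad (\<phi> j) x) (grad (\<phi> i) x))"
    by (intro set_lebesgue_integral_cong sets_domain) auto
  then show "stiffness_matrix \<Omega> a N \<phi> $$ (i, j) = stiffness_matrix \<Omega> a N \<phi> $$ (j, i)"
    using ij by (simp add: stiffness_matrix_def)
qed

lemma symm_mass: "symm_on N (\<lambda>i j. mass_matrix \<Omega> N \<phi> $$ (i, j))"
  by (simp add: symm_on_def mass_matrix_def mult.commute)

text \<open>A finite element function with vanishing gradient takes finitely many values on the connected
  domain, so it is constant, and it vanishes on the frontier.\<close>

lemma fe_grad_zero_imp_zero:
  assumes 0: "AE x\<in>\<Omega> in lebesgue. fe_grad p x = 0" and i: "i < N"
  shows "p i = 0"
proof -
  define U where "U x = (\<Sum>i<N. p i * \<phi> i x)" for x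
  have const: "\<exists>e. \<forall>y\<in>K. U y = e" if K: "K \<in> T" for K
  proof -
    obtain G e where G: "\<And>y. y \<in> K \<Longrightarrow> U y = inner G y + e" "\<And>x. x \<in> interior K \<Longrightarrow> fe_grad p x = G"
      unfolding U_def using fe_grad_on_cell[OF K, of p] by metis
    \<comment> \<open>The gradient vanishes almost everywhere and this set is open and nonempty,
      hence not null.\<close>
    have "\<exists>x\<in>interior K \<inter> \<Omega>. fe_grad p x = 0"
    proof (rule ccontr)
      assume "\<not> ?thesis"
      with 0 have "AE x in lebesgue. x \<notin> interior K \<inter> \<Omega>" by (auto elim!: eventually_mono)
      moreover have "interior K \<inter> \<Omega> \<in> sets lebesgue" using sets_domain by (intro sets.Int) auto
      ultimately have "negligible (interior K \<inter> \<Omega>)"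
        by (simp only: negligible_iff_null_sets AE_iff_null_sets)
      then show False
        using open_not_negligible[of "interior K \<inter> \<Omega>"] interior_cell_meets[OF K] dom(1) by auto
    qed
    then have "G = 0" using G(2) by auto
    then show ?thesis using G(1) by auto
  qed
  then obtain E where E: "\<And>K y. K \<in> T \<Longrightarrow> y \<in> K \<Longrightarrow> U y = E K" by metis
  have "U ` \<Omega> \<subseteq> E ` T" using E cells_cover closure_subset[of \<Omega>] by blast
  then have fin: "finite (U ` \<Omega>)" using finite_cells finite_subset by blast
  have cont: "continuous_on (closure \<Omega>) U"
    unfolding U_def using basis_space by (intro continuous_intros) (auto simp: fe_space_def)
  have "U constant_on \<Omega>"
    by (rule continuous_finite_range_constant[OF dom(2) continuous_on_subset[OF cont closure_subset] fin])
  then obtain u where u: "\<And>x. x \<in> \<Omega> \<Longrightarrow> U x = u" by (auto simp: constant_on_def)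
  \<comment> \<open>Only the empty set and the whole space have an empty frontier.\<close>
  have "frontier \<Omega> \<noteq> {}" using dom by (metis frontier_eq_empty not_bounded_UNIV)
  then obtain y where y: "y \<in> frontier \<Omega>" by blast
  then have "y \<in> closure \<Omega>" "y \<notin> \<Omega>" using dom(1) by (auto simp: frontier_def interior_open)
  moreover have "U y = 0" unfolding U_def using \<open>y \<notin> \<Omega>\<close> basis_space by (auto simp: fe_space_def intro!: sum.neutral)
  ultimately have "u = 0" using continuous_constant_on_closure[OF cont u] by auto
  moreover have "z i \<in> \<Omega>" using nodes i by (auto simp: bij_betw_def interior_nodes_def)
  ultimately have "U (z i) = 0" using u by simp
  then show ?thesis using nodal_value[OF i] by (simp add: U_def)
qed

text \<open>By coercivity the integrand is nonnegative; a zero integral forces the gradient to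
  vanish almost everywhere.\<close>

lemma stiffness_pos:
  assumes a: "diffusion_coefficient \<Omega> a"
  shows "0 \<le> quad N (\<lambda>i j. stiffness_matrix \<Omega> a N \<phi> $$ (i, j)) p"
    and "quad N (\<lambda>i j. stiffness_matrix \<Omega> a N \<phi> $$ (i, j)) p = 0 \<Longrightarrow> \<forall>i<N. p i = 0"
proof -
  obtain c where c: "0 < c" "\<And>x \<xi>. x \<in> \<Omega> \<Longrightarrow> c * (norm \<xi>)\<^sup>2 \<le> inner (a x *v \<xi>) \<xi>"
    using diffusion_coefficientE[OF a] by metis
  note int = stiffness_quad(1)[OF a, of p, unfolded set_integrable_def]
  have nn: "0 \<le> indicat_real \<Omega> x *\<^sub>R inner (a x *v fe_grad p x) (fe_grad p x)" for x
  proof (cases "x \<in> \<Omega>")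
    case True
    have "0 \<le> c * (norm (fe_grad p x))\<^sup>2" using c(1) by simp
    also have "\<dots> \<le> inner (a x *v fe_grad p x) (fe_grad p x)" by (rule c(2)[OF True])
    finally show ?thesis using True by simp
  qed simp
  show "0 \<le> quad N (\<lambda>i j. stiffness_matrix \<Omega> a N \<phi> $$ (i, j)) p"
    unfolding stiffness_quad(2)[OF a] set_lebesgue_integral_def
    by (rule Bochner_Integration.integral_nonneg) (rule nn)
  assume "quad N (\<lambda>i j. stiffness_matrix \<Omega> a N \<phi> $$ (i, j)) p = 0"
  then have "AE x in lebesgue. indicat_real \<Omega> x *\<^sub>R inner (a x *v fe_grad p x) (fe_grad p x) = 0"
    unfolding stiffness_quad(2)[OF a] set_lebesgue_integral_def
    using integral_nonneg_eq_0_iff_AE[OF int] nn by auto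
  then have "AE x\<in>\<Omega> in lebesgue. fe_grad p x = 0"
  proof (rule eventually_mono, intro impI)
    fix x assume x: "x \<in> \<Omega>" and "indicat_real \<Omega> x *\<^sub>R inner (a x *v fe_grad p x) (fe_grad p x) = 0"
    then have "c * (norm (fe_grad p x))\<^sup>2 \<le> 0" using c(2)[OF x, of "fe_grad p x"] by simp
    then show "fe_grad p x = 0" using c(1) by (simp add: mult_le_0_iff)
  qed
  then show "\<forall>i<N. p i = 0" using fe_grad_zero_imp_zero by blast
qed

lemma mass_defect_quad:
  shows "set_integrable lebesgue \<Omega> (\<lambda>x. \<Sum>i<N. \<Sum>j<N. (p i - p j)\<^sup>2 / 2 * (\<phi> i x * \<phi> j x))"
    and "quad N (\<lambda>i j. lumped (mass_matrix \<Omega> N \<phi>) $$ (i, j) - mass_matrix \<Omega> N \<phi> $$ (i, j)) p =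
      (LINT x:\<Omega>|lebesgue. \<Sum>i<N. \<Sum>j<N. (p i - p j)\<^sup>2 / 2 * (\<phi> i x * \<phi> j x))"
proof -
  note w = weighted_sum_set_integral[where N = N and w = "\<lambda>i j. (p i - p j)\<^sup>2 / 2"
      and F = "\<lambda>i j x. \<phi> i x * \<phi> j x", OF mass_integrable]
  show "set_integrable lebesgue \<Omega> (\<lambda>x. \<Sum>i<N. \<Sum>j<N. (p i - p j)\<^sup>2 / 2 * (\<phi> i x * \<phi> j x))"
    by (rule w(1))
  have M: "mass_matrix \<Omega> N \<phi> \<in> carrier_mat N N" by (simp add: mass_matrix_def)
  have "quad N (\<lambda>i j. lumped (mass_matrix \<Omega> N \<phi>) $$ (i, j) - mass_matrix \<Omega> N \<phi> $$ (i, j)) p =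
      (\<Sum>i<N. \<Sum>j<N. (p i - p j)\<^sup>2 / 2 * (LINT x:\<Omega>|lebesgue. \<phi> i x * \<phi> j x))"
    unfolding lumped_defect_quad[OF M symm_mass]
    by (intro sum.cong refl) (simp add: mass_matrix_def)
  also have "\<dots> = (LINT x:\<Omega>|lebesgue. \<Sum>i<N. \<Sum>j<N. (p i - p j)\<^sup>2 / 2 * (\<phi> i x * \<phi> j x))"
    by (rule w(2))
  finally show "quad N (\<lambda>i j. lumped (mass_matrix \<Omega> N \<phi>) $$ (i, j) - mass_matrix \<Omega> N \<phi> $$ (i, j)) p =
      (LINT x:\<Omega>|lebesgue. \<Sum>i<N. \<Sum>j<N. (p i - p j)\<^sup>2 / 2 * (\<phi> i x * \<phi> j x))" .
qed

text \<open>The products \<open>\<phi> i x * \<phi> j x\<close> are nonnegative weights of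
  squares.\<close>

lemma mass_defect_nonneg:
  "0 \<le> quad N (\<lambda>i j. lumped (mass_matrix \<Omega> N \<phi>) $$ (i, j) - mass_matrix \<Omega> N \<phi> $$ (i, j)) p"
  unfolding mass_defect_quad(2) set_lebesgue_integral_def
proof (rule Bochner_Integration.integral_nonneg)
  fix x
  show "0 \<le> indicat_real \<Omega> x *\<^sub>R (\<Sum>i<N. \<Sum>j<N. (p i - p j)\<^sup>2 / 2 * (\<phi> i x * \<phi> j x))"
  proof (cases "x \<in> \<Omega>")
    case True
    then obtain K where "K \<in> T" "x \<in> K" using cells_cover closure_subset by blast
    then show ?thesis using basis_on_cell(1) by (auto intro!: mult_nonneg_nonneg sum_nonneg)
  qed simp
qed

text \<open>Integrates the local estimate. In the constant, the 2 comes from the representation of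
  the defect by squares and \<open>c\<close> from coercivity.\<close>

lemma mass_defect_le:
  assumes a: "diffusion_coefficient \<Omega> a" and c: "0 < c"
    and coercive: "\<And>x \<xi>. x \<in> \<Omega> \<Longrightarrow> c * (norm \<xi>)\<^sup>2 \<le> inner (a x *v \<xi>) \<xi>"
  shows "quad N (\<lambda>i j. lumped (mass_matrix \<Omega> N \<phi>) $$ (i, j) - mass_matrix \<Omega> N \<phi> $$ (i, j)) p \<le>
    (mesh_size T)\<^sup>2 / (2 * c) * quad N (\<lambda>i j. stiffness_matrix \<Omega> a N \<phi> $$ (i, j)) p"
proof -
  let ?h = "mesh_size T"
  have "(LINT x:\<Omega>|lebesgue. \<Sum>i<N. \<Sum>j<N. (p i - p j)\<^sup>2 / 2 * (\<phi> i x * \<phi> j x)) \<le>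
      (LINT x:\<Omega>|lebesgue. ?h\<^sup>2 / (2 * c) * inner (a x *v fe_grad p x) (fe_grad p x))"
  proof (rule set_integral_mono_AE[OF mass_defect_quad(1)])
    show "set_integrable lebesgue \<Omega> (\<lambda>x. ?h\<^sup>2 / (2 * c) * inner (a x *v fe_grad p x) (fe_grad p x))"
      by (intro set_integrable_mult_right stiffness_quad(1)[OF a])
    show "AE x\<in>\<Omega> in lebesgue. (\<Sum>i<N. \<Sum>j<N. (p i - p j)\<^sup>2 / 2 * (\<phi> i x * \<phi> j x)) \<le>
        ?h\<^sup>2 / (2 * c) * inner (a x *v fe_grad p x) (fe_grad p x)"
      using AE_interior_cell
    proof (rule eventually_mono, intro impI)
      fix x assume x: "x \<in> \<Omega>" and "x \<in> \<Omega> \<longrightarrow> (\<exists>K\<in>T. x \<in> interior K)"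
      then obtain K where K: "K \<in> T" "x \<in> interior K" by blast
      have "(\<Sum>i<N. \<Sum>j<N. (p i - p j)\<^sup>2 / 2 * (\<phi> i x * \<phi> j x)) =
          (\<Sum>i<N. \<Sum>j<N. \<phi> i x * \<phi> j x * (p i - p j)\<^sup>2) / 2"
        unfolding sum_divide_distrib by (intro sum.cong refl) simp
      also have "\<dots> \<le> ?h\<^sup>2 * (norm (fe_grad p x))\<^sup>2 / 2"
        using local_defect_le[OF K, of p] by simp
      also have "\<dots> = ?h\<^sup>2 / (2 * c) * (c * (norm (fe_grad p x))\<^sup>2)" using c by simp
      also have "\<dots> \<le> ?h\<^sup>2 / (2 * c) * inner (a x *v fe_grad p x) (fe_grad p x)"
        using c by (intro mult_left_mono coercive x) auto
      finally show "(\<Sum>i<N. \<Sum>j<N. (p i - p j)\<^sup>2 / 2 * (\<phi> i x * \<phi> j x)) \<le>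
        ?h\<^sup>2 / (2 * c) * inner (a x *v fe_grad p x) (fe_grad p x)" .
    qed
  qed
  then show ?thesis by (simp add: mass_defect_quad(2) stiffness_quad(2)[OF a])
qed

lemma saddle_pair_fe:
  assumes a: "diffusion_coefficient \<Omega> a" and b: "diffusion_coefficient \<Omega> b"
    and c: "0 < c" "\<And>x \<xi>. x \<in> \<Omega> \<Longrightarrow> c * (norm \<xi>)\<^sup>2 \<le> inner (a x *v \<xi>) \<xi>"
      "\<And>x \<xi>. x \<in> \<Omega> \<Longrightarrow> c * (norm \<xi>)\<^sup>2 \<le> inner (b x *v \<xi>) \<xi>"
    and \<tau>: "0 < \<tau>" "(mesh_size T)\<^sup>2 / (2 * c) \<le> \<epsilon> * \<tau>"
  shows "saddle_pair N (stiffness_matrix \<Omega> a N \<phi>) (stiffness_matrix \<Omega> b N \<phi>)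
    (mass_matrix \<Omega> N \<phi>) (lumped (mass_matrix \<Omega> N \<phi>)) \<tau> \<epsilon>"
proof (unfold_locales)
  show "quad N (\<lambda>i j. lumped (mass_matrix \<Omega> N \<phi>) $$ (i, j) - mass_matrix \<Omega> N \<phi> $$ (i, j)) p
      \<le> \<epsilon> * (\<tau> * quad N (\<lambda>i j. stiffness_matrix \<Omega> a N \<phi> $$ (i, j)) p)" for p
    using mass_defect_le[OF a c(1,2), of p] mult_right_mono[OF \<tau>(2) stiffness_pos(1)[OF a, of p]]
    by (simp add: mult.assoc)
  show "quad N (\<lambda>i j. lumped (mass_matrix \<Omega> N \<phi>) $$ (i, j) - mass_matrix \<Omega> N \<phi> $$ (i, j)) p
      \<le> \<epsilon> * (\<tau> * quad N (\<lambda>i j. stiffness_matrix \<Omega> b N \<phi> $$ (i, j)) p)" for p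
    using mass_defect_le[OF b c(1,3), of p] mult_right_mono[OF \<tau>(2) stiffness_pos(1)[OF b, of p]]
    by (simp add: mult.assoc)
  show "symm_on N (\<lambda>i j. lumped (mass_matrix \<Omega> N \<phi>) $$ (i, j))"
    by (simp add: symm_on_def lumped_def mat_diag_def mass_matrix_def)
qed (fact \<tau>(1) symm_mass mass_defect_nonneg symm_stiffness[OF a] symm_stiffness[OF b]
   stiffness_pos(1)[OF a] stiffness_pos(2)[OF a] stiffness_pos(1)[OF b] stiffness_pos(2)[OF b]
   | assumption | simp add: stiffness_matrix_def mass_matrix_def lumped_def mat_diag_def)+

end

section \<open>The convergence bound\<close>

lemma length_le_sum_list_fst: "0 \<notin> fst ` set bs \<Longrightarrow> length bs \<le> sum_list (map fst bs)"
  by (induction bs) auto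

lemma jordan_transformation_max_block_pos:
  assumes R: "R \<in> carrier_mat n n" and n: "0 < n" and j: "jordan_transformation R V bs"
  shows "0 < max_block bs"
proof -
  have "bs \<noteq> []" using jordan_transformation_wit(2)[OF R j] n by auto
  then have "max_block bs \<in> fst ` set bs" unfolding max_block_def by (intro Max_in) auto
  then show ?thesis using j unfolding jordan_transformation_def by (metis not_gr_zero)
qed

text \<open>Of \<open>4^(m - 1)\<close>, one half \<open>2^(m - 1)\<close> appears in
  \<open>C\<^sub>0\<close> and the other is at most \<open>q^(m - 1)\<close>, where
  \<open>q = n * cond2 V\<close> is at least 2. The remaining factors are at least 1;
  \<open>f\<close> stands for the dimension.\<close>

lemma jordan_transformation_const_le:
  fixes R :: "complex Matrix.mat"
  assumes R: "R \<in> carrier_mat n n" and n: "2 \<le> n" and j: "jordan_transformation R V bs"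
    and \<rho>: "0 \<le> \<rho>" "\<rho> < 1" and f: "1 \<le> f"
  defines "m \<equiv> max_block bs"
  shows "real n * cond2 V / (1 / 4) ^ (m - 1) \<le>
    2 ^ (m - 1) * jordan_constant n V bs ^ m * (1 + \<rho>) * f / (1 - \<rho>) ^ m"
proof -
  have V: "V \<in> carrier_mat n n" "invertible_mat V" "0 \<notin> fst ` set bs"
    using j R by (auto simp: jordan_transformation_def)
  have \<kappa>: "1 \<le> cond2 V" using cond2_ge_1[OF V(1,2)] n by simp
  have m: "0 < m" unfolding m_def using jordan_transformation_max_block_pos[OF R _ j] n by simp
  have len: "length bs \<le> n"
    using length_le_sum_list_fst[OF V(3)] jordan_transformation_wit(2)[OF R j] by simp
  define q where "q = real n * cond2 V"
  have "2 * 1 \<le> q" unfolding q_def using n \<kappa> by (intro mult_mono) auto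
  then have q: "2 \<le> q" by simp
  have "q \<le> jordan_constant n V bs"
  proof -
    have "q * 1 \<le> q * (1 + sqrt (real n - real (length bs)))"
      using q len by (intro mult_left_mono) auto
    then show ?thesis by (simp add: q_def jordan_constant_def mult_ac)
  qed
  then have "q ^ m \<le> jordan_constant n V bs ^ m" using q by (intro power_mono) auto
  moreover have "q * 2 ^ (m - 1) \<le> q * q ^ (m - 1)" using q by (intro mult_left_mono power_mono) auto
  \<comment> \<open>Here \<open>m > 0\<close> matters, as the subtraction is truncated.\<close>
  moreover have "q * q ^ (m - 1) = q ^ m" using m by (metis power_eq_if not_gr_zero)
  ultimately have 1: "q * 2 ^ (m - 1) \<le> jordan_constant n V bs ^ m" by simp
  have "0 \<le> q * 2 ^ (m - 1)" using q by simp
  then have C0: "0 \<le> jordan_constant n V bs ^ m" using 1 by (rule order_trans)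
  have "(1 - \<rho>) ^ m \<le> 1 ^ m" using \<rho> by (intro power_mono) auto
  moreover have "1 * 1 \<le> (1 + \<rho>) * f" using \<rho> f by (intro mult_mono) auto
  ultimately have 2: "1 \<le> (1 + \<rho>) * f / (1 - \<rho>) ^ m" using \<rho> by (simp add: le_divide_eq)
  have "real n * cond2 V / (1 / 4) ^ (m - 1) = q * 4 ^ (m - 1)"
    by (simp add: q_def power_one_over)
  also have "(4::real) ^ (m - 1) = 2 ^ (m - 1) * 2 ^ (m - 1)" by (simp flip: power_mult_distrib)
  also have "q * (2 ^ (m - 1) * 2 ^ (m - 1)) = 2 ^ (m - 1) * (q * 2 ^ (m - 1)) * 1" by simp
  also have "\<dots> \<le> 2 ^ (m - 1) * jordan_constant n V bs ^ m * ((1 + \<rho>) * f / (1 - \<rho>) ^ m)"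
    using 1 2 C0 q by (intro mult_mono mult_nonneg_nonneg) auto
  finally show ?thesis by (simp add: mult.assoc)
qed

theorem corollary1:
  fixes \<Omega> :: "(real ^ 'd) set"
    and a b :: "real ^ 'd \<Rightarrow> real ^ 'd ^ 'd"
    and \<sigma> :: real
  assumes "polyhedral_domain \<Omega>" and "bounded \<Omega>"
    and "diffusion_coefficient \<Omega> a" and "diffusion_coefficient \<Omega> b"
  shows "\<exists>C>0. \<forall>T N \<phi> \<tau>.
    triangulates T \<Omega> \<and> shape_regular \<sigma> T \<and> nodal_basis \<Omega> T N \<phi> \<and> 0 < N \<and>
    0 < \<tau> \<and> C * (mesh_size T)\<^sup>2 \<le> \<tau> \<longrightarrow>
    (let M = mass_matrix \<Omega> N \<phi>;
         A = stiffness_matrix \<Omega> a N \<phi>;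
         B = stiffness_matrix \<Omega> b N \<phi>;
         \<A> = saddle_matrix \<tau> A B M;
         \<B> = saddle_matrix \<tau> A B (lumped M);
         R = \<A> * mat_inv \<B>;
         E = mat_inv \<B> * \<A> - 1\<^sub>m (2 * N);
         \<theta> = spectral_radius (map_mat complex_of_real (mat_inv \<B> * \<A>)) / 2;
         \<rho>E = spectral_radius (map_mat complex_of_real E)
     in invertible_mat \<B> \<and>
        \<theta> < 1 \<and> gmres_rate_bounded R \<theta> \<and>
        (\<forall>V bs rhs v k.
           jordan_transformation (map_mat complex_of_real R) V bs \<and> gmres_iterates R rhs v \<longrightarrow>
           (let m = max_block bs;
                C\<^sub>R = jordan_constant (2 * N) V bs;
                C\<^sub>0 = 2 ^ (m - 1) * C\<^sub>R ^ m * (1 + \<rho>E) * real (fe_dim \<Omega> T) / (1 - \<rho>E) ^ m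
            in vec_norm2 (residual R rhs (v k)) / vec_norm2 (residual R rhs (v 0)) \<le> C\<^sub>0 * \<theta> ^ k)))"
proof -
  obtain ca where ca: "0 < ca" "\<And>x \<xi>. x \<in> \<Omega> \<Longrightarrow> ca * (norm \<xi>)\<^sup>2 \<le> inner (a x *v \<xi>) \<xi>"
    using diffusion_coefficientE[OF assms(3)] by metis
  obtain cb where cb: "0 < cb" "\<And>x \<xi>. x \<in> \<Omega> \<Longrightarrow> cb * (norm \<xi>)\<^sup>2 \<le> inner (b x *v \<xi>) \<xi>"
    using diffusion_coefficientE[OF assms(4)] by metis
  \<comment> \<open>One coercivity constant for both coefficients, independent of mesh and
    \<open>\<tau>\<close>.\<close>
  define c where "c = min ca cb"
  have c: "0 < c" "\<And>x \<xi>. x \<in> \<Omega> \<Longrightarrow> c * (norm \<xi>)\<^sup>2 \<le> inner (a x *v \<xi>) \<xi>"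
    "\<And>x \<xi>. x \<in> \<Omega> \<Longrightarrow> c * (norm \<xi>)\<^sup>2 \<le> inner (b x *v \<xi>) \<xi>"
    using ca(1) cb(1) order_trans[OF mult_right_mono ca(2)] order_trans[OF mult_right_mono cb(2)]
    by (auto simp: c_def)
  show ?thesis
  \<comment> \<open>Chosen so that the defect constant \<open>h^2 / (2 * c)\<close> is at most
    \<open>\<tau> / 6\<close>.\<close>
  proof (intro exI[of _ "3 / c"] conjI allI impI, goal_cases)
    case 1
    then show ?case using c(1) by simp
  next
    case (2 T N \<phi> \<tau>)
    then have hyps: "triangulates T \<Omega>" "nodal_basis \<Omega> T N \<phi>" "0 < N" "0 < \<tau>" "3 / c * (mesh_size T)\<^sup>2 \<le> \<tau>"
      by auto
    obtain z where "bij_betw z {..<N} (interior_nodes \<Omega> T)"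
      "\<forall>i<N. \<phi> i \<in> fe_space \<Omega> T \<and> (\<forall>j<N. \<phi> i (z j) = (if i = j then 1 else 0))"
      using hyps(2) unfolding nodal_basis_def by blast
    then interpret fe_mesh \<Omega> T N \<phi> z
      using assms(1,2) hyps(1) by unfold_locales (auto simp: polyhedral_domain_def)
    define M where "M = mass_matrix \<Omega> N \<phi>"
    define A where "A = stiffness_matrix \<Omega> a N \<phi>"
    define B where "B = stiffness_matrix \<Omega> b N \<phi>"
    have "(mesh_size T)\<^sup>2 / (2 * c) \<le> 1 / 6 * \<tau>" using hyps(5) c(1) by (simp add: field_simps)
    then interpret saddle_pair N A B M "lumped M" \<tau> "1 / 6"
      unfolding A_def B_def M_def using saddle_pair_fe[OF assms(3,4) c hyps(4)] by blast
    define R where "R = S * W"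
    define \<theta> where "\<theta> = spectral_radius (map_mat complex_of_real (W * S)) / 2"
    define \<rho>E where "\<rho>E = spectral_radius (map_mat complex_of_real (W * S - 1\<^sub>m (2 * N)))"
    have R: "R \<in> carrier_mat (2 * N) (2 * N)" unfolding R_def by (rule mult_carrier_mat[OF carriers(1) P_inv(1)])
    then have Rc: "map_mat complex_of_real R \<in> carrier_mat (2 * N) (2 * N)" by simp
    \<comment> \<open>With \<open>\<epsilon> = 1 / 6\<close> the spectral radius lies between
      \<open>5 / 6\<close> and \<open>7 / 6\<close>.\<close>
    have \<theta>: "5 / 12 \<le> \<theta>" "\<theta> < 1" using spectral_radius_left[OF hyps(3)] by (auto simp: \<theta>_def)
    have \<rho>E: "0 \<le> \<rho>E" "\<rho>E < 1" using spectral_radius_error[OF hyps(3)] by (auto simp: \<rho>E_def)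
    \<comment> \<open>Taken with \<open>s = 1 / 4\<close>: the rate
      \<open>1 / 6 + 1 / 4 = 5 / 12\<close> is at most \<open>\<theta>\<close>.\<close>
    have bound: "vec_norm2 (residual R rhs (v k)) \<le>
        (real (2 * N) * cond2 V / (1 / 4) ^ (max_block bs - 1)) * \<theta> ^ k * vec_norm2 (residual R rhs (v 0))"
      if "jordan_transformation (map_mat complex_of_real R) V bs" "gmres_iterates R rhs v" for V bs rhs v k
      by (rule gmres_jordan_bound[OF R _ that, of "1 / 6"])
         (use hyps(3) \<theta> right_eigenvalue_near_1 in \<open>auto simp: R_def\<close>)
    \<comment> \<open>A single fixed transformation gives a constant valid for all right-hand sides
      and iterates.\<close>
    obtain V0 bs0 where "jordan_transformation (map_mat complex_of_real R) V0 bs0"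
      using jordan_transformation_exists[OF Rc] by blast
    then have rate: "gmres_rate_bounded R \<theta>" unfolding gmres_rate_bounded_def using bound by blast
    have "vec_norm2 (residual R rhs (v k)) / vec_norm2 (residual R rhs (v 0)) \<le>
        2 ^ (max_block bs - 1) * jordan_constant (2 * N) V bs ^ max_block bs * (1 + \<rho>E) * real (fe_dim \<Omega> T) /
        (1 - \<rho>E) ^ max_block bs * \<theta> ^ k"
      if j: "jordan_transformation (map_mat complex_of_real R) V bs" and g: "gmres_iterates R rhs v" for V bs rhs v k
    proof -
      have "residual R rhs (v 0) \<noteq> 0\<^sub>v (2 * N)" "dim_vec (residual R rhs (v 0)) = 2 * N"
        using g R by (auto simp: gmres_iterates_def residual_def)
      then have "vec_norm2 (residual R rhs (v 0)) > 0"
        using vec_norm2_eq_0_iff vec_norm2_nonneg by (metis less_eq_real_def)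
      then have "vec_norm2 (residual R rhs (v k)) / vec_norm2 (residual R rhs (v 0)) \<le>
          (real (2 * N) * cond2 V / (1 / 4) ^ (max_block bs - 1)) * \<theta> ^ k"
        using bound[OF j g, of k] by (simp only: divide_le_eq if_True)
      also have "\<dots> \<le> 2 ^ (max_block bs - 1) * jordan_constant (2 * N) V bs ^ max_block bs * (1 + \<rho>E) * real (fe_dim \<Omega> T) /
          (1 - \<rho>E) ^ max_block bs * \<theta> ^ k"
        using fe_dim_pos[OF hyps(3)] hyps(3) \<theta>(1)
        by (intro mult_right_mono jordan_transformation_const_le[OF Rc _ j \<rho>E]) auto
      finally show ?thesis .
    qed
    then show ?case
      unfolding Let_def
      using invertible_P \<theta>(2) rate
      unfolding \<theta>_def \<rho>E_def R_def M_def A_def B_def by blast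
  qed
qed

end
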